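(* Let $g$ be a real-valued function whose domain contains $[1-\delta,1+\delta]$ for some $\delta>0$, such that $g$ is differentiable at $1$ and $g'(1)\neq 0$. Then $$\frac{g(\omega/\ell_2)-g(1)}{g'(1)/\sqrt{\ell_2}} \Rightarrow \Phi .$$
   Context: For a positive integer $m$, $\omega(m)$ denotes the number of distinct prime divisors of $m$. $\ell_2(m)=\log\log m$, which is defined and positive for $m\ge 3$. $\Phi$ is the distribution function of the standard normal distribution. For $n\in\mathbb{N}$, $\mathbb{P}_n$ is the probability measure on $\{1,\dots,n\}$ placing mass $1/n$ at each integer. Convergence notation "$\Rightarrow$": let $f^\star_n$ be real-valued functions defined on sets $\mathbb{M}_n\subseteq\{1,\dots,n\}$ for all sufficiently large $n$, with $\mathbb{P}_n(\mathbb{M}_n)\to 1$. For a distribution function $F$, $f^\star_n\Rightarrow F$ means $\mathbb{P}_n(\{m\in\mathbb{M}_n: f^\star_n(m)\le x\})\to F(x)$ as $n\to\infty$ for every continuity point $x$ of $F$. If a single function $f$ is used for all $n$, this is written $f\Rightarrow F$. The domains $\mathbb{M}_n$ are the sets of integers $m\le n$ at which the expression is defined; here these are the $m\ge 3$ with $\omega(m)/\ell_2(m)$ in the domain of $g$. Any choice of domains with $\mathbb{P}_n(\mathbb{M}_n)\to1$ on which the expression is defined gives the same notion. *)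

theory Defs
  imports "HOL-Probability.Probability" "HOL-Computational_Algebra.Primes"
begin

definition omega :: "nat \<Rightarrow> nat"
  where "omega m = card (prime_factors m)"

text \<open>Meaningful (and positive) only for \<open>m \<ge> 3\<close>; it is only used there.\<close>

definition ell2 :: "nat \<Rightarrow> real"
  where "ell2 m = ln (ln (real m))"

abbreviation prob_upto :: "nat \<Rightarrow> nat set \<Rightarrow> real"
  where "prob_upto n \<equiv> measure (uniform_count_measure {1..n})"

text \<open>
  Convergence in distribution of functions \<open>f n\<close> on domains \<open>M n \<subseteq> {1..n}\<close> of asymptotically full
  measure. The functions are total in HOL, but only their values on \<open>M n\<close> matter. The conditions
  on the domains are part of the definition, so they have to be proved whenever it is asserted.
\<close>

definition converges_in_distr ::
    "(nat \<Rightarrow> nat set) \<Rightarrow> (nat \<Rightarrow> nat \<Rightarrow> real) \<Rightarrow> (real \<Rightarrow> real) \<Rightarrow> bool"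
  where "converges_in_distr M f F \<longleftrightarrow>
    (\<forall>\<^sub>F n in sequentially. M n \<subseteq> {1..n}) \<and>
    (\<lambda>n. prob_upto n (M n)) \<longlonglongrightarrow> 1 \<and>
    (\<forall>x. isCont F x \<longrightarrow> (\<lambda>n. prob_upto n {m \<in> M n. f n m \<le> x}) \<longlonglongrightarrow> F x)"

abbreviation std_normal_cdf :: "real \<Rightarrow> real"
  where "std_normal_cdf \<equiv> cdf std_normal_distribution"

text \<open>The integers \<open>m \<le> n\<close> at which \<open>g (omega m / ell2 m)\<close> is defined, if \<open>D\<close> is the domain of \<open>g\<close>.\<close>

definition ratio_domain :: "real set \<Rightarrow> nat \<Rightarrow> nat set"
  where "ratio_domain D n = {m \<in> {1..n}. 3 \<le> m \<and> real (omega m) / ell2 m \<in> D}"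

end

theory Submission
  imports Defs "HOL-Real_Asymp.Real_Asymp" "HOL-Library.Log_Nat"
begin

text \<open>
  Discarding the primes above \<open>n powr (1 / ell2 n)\<close> changes \<open>omega\<close> by \<open>o(sqrt (ell2 n))\<close> on average, by
  Mertens' theorem. The moments of the number of remaining prime divisors agree up to negligible
  errors with those of a sum of independent Bernoulli variables with parameters \<open>1 / p\<close>. The
  exponential moments of the model bound the Taylor remainder of the characteristic function, so the
  characteristic functions agree in the limit as well; that of the model is an explicit product which
  tends to \<open>exp (- t\<^sup>2 / 2)\<close>. Levy's continuity theorem then yields the theorem of Erdos and Kac, from
  which the claim follows by linearising \<open>g\<close> at \<open>1\<close>.
\<close>

section \<open>Mertens' theorems\<close>

text \<open>The cutoff z = n powr (1 / ell2 n) has to meet two opposite demands. Since ln (ln z) =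
  ell2 n - ln (ell2 n), Mertens' theorem shows that the discarded primes carry a mean of only about
  ln (ell2 n), below the scale sqrt (ell2 n) of the limit law. On the other hand, a moment of order
  k is assembled from at most about z^k divisibility events, each with an error of at most 1 / n,
  and every fixed power of z is n^o(1). The degree N of the Taylor polynomial is therefore kept
  fixed while n grows, and its remainder has to be small uniformly in n. The scaling provides this:
  at an argument of size t / sqrt (ell2 n) the exponential moments of the centred model stay
  bounded, and they turn the remainder into a multiple of 2^-N. Exponential moments are estimated in
  the model only. On the arithmetic side the remainder is reduced to one even moment, which is
  compared with the model like all the others.\<close>

lemma card_multiples_upto:
  fixes d n :: nat
  assumes "d > 0"
  shows "card {m \<in> {1..n}. d dvd m} = n div d"
proof -
  have "{m \<in> {1..n}. d dvd m} = (\<lambda>k. d * k) ` {1..n div d}"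
  proof (intro equalityI subsetI)
    fix m assume "m \<in> {m \<in> {1..n}. d dvd m}"
    then obtain k where k: "m = d * k" "1 \<le> m" "m \<le> n" by auto
    then have "k \<in> {1..n div d}" using assms
      by (auto simp: less_eq_div_iff_mult_less_eq mult.commute Suc_le_eq)
    then show "m \<in> (\<lambda>k. d * k) ` {1..n div d}" using k by auto
  next
    fix m assume "m \<in> (\<lambda>k. d * k) ` {1..n div d}"
    then show "m \<in> {m \<in> {1..n}. d dvd m}" using assms
      by (auto simp: less_eq_div_iff_mult_less_eq mult.commute Suc_le_eq)
  qed
  moreover have "inj_on (\<lambda>k. d * k) {1..n div d}" using assms by (auto simp: inj_on_def)
  ultimately show ?thesis by (simp add: card_image)
qed

section \<open>Logarithms of prime factorisations and Chebyshev's upper bound\<close>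

definition primes_upto :: "nat \<Rightarrow> nat set"
  where "primes_upto n = {p. prime p \<and> p \<le> n}"

lemma finite_primes_upto [simp, intro]: "finite (primes_upto n)"
  by (rule finite_subset[of _ "{..n}"]) (auto simp: primes_upto_def)

lemma ln_prime_nonneg: "prime p \<Longrightarrow> 0 \<le> ln (real p)" for p :: nat
  using prime_ge_1_nat[of p] by (intro ln_ge_zero) linarith

text \<open>The index set is enlarged from the prime factors of \<open>m\<close> to all primes up to
  \<open>n\<close>, where the extra multiplicities are 0. It then no longer depends on
  \<open>m\<close>, so sums over \<open>m\<close> and \<open>p\<close> can be exchanged.\<close>

lemma ln_eq_sum_multiplicity:
  assumes "0 < m" "m \<le> n"
  shows "ln (real m) = (\<Sum>p\<in>primes_upto n. real (multiplicity p m) * ln (real p))"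
proof -
  have "m = (\<Prod>p\<in>prime_factors m. p ^ multiplicity p m)"
    using assms(1) by (rule prime_factorization_nat)
  then have "real m = real (\<Prod>p\<in>prime_factors m. p ^ multiplicity p m)" by (rule arg_cong[where f = real])
  also have "\<dots> = (\<Prod>p\<in>prime_factors m. real p ^ multiplicity p m)" by simp
  also have "ln \<dots> = (\<Sum>p\<in>prime_factors m. ln (real p ^ multiplicity p m))"
    by (rule ln_prod) (auto intro!: prime_gt_0_nat)
  also have "\<dots> = (\<Sum>p\<in>prime_factors m. real (multiplicity p m) * ln (real p))"
    by (simp add: ln_realpow)
  also have "\<dots> = (\<Sum>p\<in>primes_upto n. real (multiplicity p m) * ln (real p))"
  proof (rule sum.mono_neutral_left)
    show "prime_factors m \<subseteq> primes_upto n" using assms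
      by (auto simp: primes_upto_def prime_factors_dvd dest: dvd_imp_le)
    show "\<forall>p\<in>primes_upto n - prime_factors m. real (multiplicity p m) * ln (real p) = 0" using assms
      by (auto simp: primes_upto_def prime_factors_dvd not_dvd_imp_multiplicity_0)
  qed auto
  finally show ?thesis .
qed

lemma sum_ln_primes_le_ln:
  assumes "0 < m" "finite Q" "\<And>p. p \<in> Q \<Longrightarrow> prime p \<and> p dvd m"
  shows "(\<Sum>p\<in>Q. ln (real p)) \<le> ln (real m)"
proof -
  have "Q \<subseteq> primes_upto m" using assms by (auto simp: primes_upto_def dest: dvd_imp_le)
  moreover have "1 \<le> multiplicity p m" if "p \<in> Q" for p
    using assms(1) assms(3)[OF that] by (intro multiplicity_geI) auto
  ultimately have "(\<Sum>p\<in>Q. ln (real p)) \<le> (\<Sum>p\<in>Q. real (multiplicity p m) * ln (real p))"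
    using assms(3) by (intro sum_mono) (simp add: mult_le_cancel_right1 prime_gt_0_nat prime_ge_1_nat)
  also have "\<dots> \<le> (\<Sum>p\<in>primes_upto m. real (multiplicity p m) * ln (real p))"
    using \<open>Q \<subseteq> primes_upto m\<close>
    by (intro sum_mono2) (auto simp: primes_upto_def intro!: mult_nonneg_nonneg ln_prime_nonneg)
  also have "\<dots> = ln (real m)" using ln_eq_sum_multiplicity[of m m] assms(1) by simp
  finally show ?thesis .
qed

text \<open>The primes in \<open>(\<lceil>n/2\<rceil>, n]\<close> all divide \<open>n choose \<lceil>n/2\<rceil> \<le> 2 ^ n\<close>.\<close>

lemma chebyshev_theta_upper: "(\<Sum>p\<in>primes_upto n. ln (real p)) \<le> 4 * ln 2 * real n"
proof (induction n rule: less_induct)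
  case (less n)
  show ?case
  proof (cases "n \<ge> 2")
    case False
    then have "primes_upto n = {}" by (auto simp: primes_upto_def dest: prime_ge_2_nat)
    then show ?thesis by simp
  next
    case True
    \<comment> \<open>Rounding up gives \<open>n - j \<le> j\<close>, so a prime above
      \<open>j\<close> divides neither of the factorials in the denominator of the binomial
      coefficient.\<close>
    define j where "j = n - n div 2"
    have j: "j < n" "n - j \<le> j" "2 * j \<le> n + 1" "j \<le> n" using True by (auto simp: j_def)
    have "primes_upto n = primes_upto j \<union> {p. prime p \<and> j < p \<and> p \<le> n}"
      using j by (auto simp: primes_upto_def)
    then have "(\<Sum>p\<in>primes_upto n. ln (real p)) =
        (\<Sum>p\<in>primes_upto j. ln (real p)) + (\<Sum>p\<in>{p. prime p \<and> j < p \<and> p \<le> n}. ln (real p))"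
      by (simp, subst sum.union_disjoint) (auto simp: primes_upto_def)
    also have "(\<Sum>p\<in>{p. prime p \<and> j < p \<and> p \<le> n}. ln (real p)) \<le> ln (real (n choose j))"
    proof (rule sum_ln_primes_le_ln)
      show "0 < n choose j" using j by simp
      fix p assume p: "p \<in> {p. prime p \<and> j < p \<and> p \<le> n}"
      then have "p dvd fact n" by (simp add: prime_dvd_fact_iff)
      also have "(fact n :: nat) = fact j * fact (n - j) * (n choose j)"
        using binomial_fact_lemma[OF j(4)] by simp
      finally have "p dvd fact j \<or> p dvd fact (n - j) \<or> p dvd (n choose j)"
        using p by (simp add: prime_dvd_mult_iff)
      then show "prime p \<and> p dvd (n choose j)" using p j by (auto simp: prime_dvd_fact_iff)
    qed auto
    also have "ln (real (n choose j)) \<le> ln (2 ^ n)"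
    proof -
      have "n choose j \<le> (\<Sum>i\<le>n. n choose i)" using j by (intro member_le_sum) auto
      also have "\<dots> = 2 ^ n" by (rule choose_row_sum)
      finally have "real (n choose j) \<le> 2 ^ n" by (metis numeral_power_eq_of_nat_cancel_iff of_nat_le_iff)
      then show ?thesis using j by (subst ln_le_cancel_iff) auto
    qed
    also have "ln (2 ^ n :: real) = real n * ln 2" by (simp add: ln_realpow)
    also have "(\<Sum>p\<in>primes_upto j. ln (real p)) \<le> 4 * ln 2 * real j" by (rule less.IH) (use j in auto)
    \<comment> \<open>This is where the constant 4 comes from: \<open>2 * j \<le> n + 1\<close>
      gives 4 j + n \<le> 3 n + 2, which is at most 4 n as soon as n \<ge> 2.\<close>
    also have "4 * ln 2 * real j + real n * ln 2 \<le> 4 * ln 2 * real n"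
    proof -
      have "4 * real j + real n \<le> 4 * real n" using j True by linarith
      then have "(4 * real j + real n) * ln 2 \<le> 4 * real n * ln 2" by (intro mult_right_mono) auto
      then show ?thesis by (simp add: algebra_simps)
    qed
    finally show ?thesis by simp
  qed
qed

section \<open>Legendre's formula, a weak form of Stirling's, and Mertens' first theorem\<close>

text \<open>Legendre's formula: the exponent of \<open>p\<close> in n! is the sum of
  \<open>n div p ^ k\<close> over k. The term k = 1 alone gives the lower bound; removing the floors
  and summing the geometric series gives the upper one.\<close>

lemma sum_multiplicity_bounds:
  fixes p n :: nat
  assumes "prime p"
  shows "real n / real p - 1 \<le> (\<Sum>m\<in>{1..n}. real (multiplicity p m))"
    and "(\<Sum>m\<in>{1..n}. real (multiplicity p m)) \<le> real n / (real p - 1)"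
proof -
  have p: "p \<ge> 2" using assms by (rule prime_ge_2_nat)
  have mult: "multiplicity p m = card {k \<in> {1..n}. p ^ k dvd m}" if m: "m \<in> {1..n}" for m
  proof -
    \<comment> \<open>No exponent exceeds \<open>n\<close>, so the range \<open>{1..n}\<close>,
      which is the same for all \<open>m\<close>, loses nothing.\<close>
    have "multiplicity p m < 2 ^ multiplicity p m" by simp
    also have "\<dots> \<le> p ^ multiplicity p m" using p by (intro power_mono) auto
    also have "\<dots> \<le> m" using m by (intro dvd_imp_le multiplicity_dvd) auto
    finally have "multiplicity p m \<le> n" using m by auto
    have "p ^ k dvd m \<longleftrightarrow> k \<le> multiplicity p m" for k
      using p m by (intro power_dvd_iff_le_multiplicity) auto
    then have "{k \<in> {1..n}. p ^ k dvd m} = {k \<in> {1..n}. k \<le> multiplicity p m}" by presburger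
    also have "\<dots> = {1..multiplicity p m}" using \<open>multiplicity p m \<le> n\<close> by fastforce
    finally have "card {k \<in> {1..n}. p ^ k dvd m} = card {1..multiplicity p m}" by presburger
    also have "\<dots> = multiplicity p m" by (rule card_atLeastAtMost[THEN trans]) presburger
    finally show ?thesis by (rule sym)
  qed
  have swap: "(\<Sum>m\<in>{1..n}. real (multiplicity p m)) = (\<Sum>k\<in>{1..n}. real (n div p ^ k))"
  proof -
    have "(\<Sum>m\<in>{1..n}. multiplicity p m) = (\<Sum>m\<in>{1..n}. card {k \<in> {1..n}. p ^ k dvd m})"
      by (intro sum.cong refl mult)
    also have "\<dots> = (\<Sum>k\<in>{1..n}. card {m \<in> {1..n}. p ^ k dvd m})"
      by (rule sum_multicount_gen) auto
    also have "\<dots> = (\<Sum>k\<in>{1..n}. n div p ^ k)"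
      using p by (intro sum.cong refl card_multiples_upto) auto
    finally show ?thesis unfolding of_nat_sum[symmetric] by (rule arg_cong[where f = real])
  qed
  show "real n / real p - 1 \<le> (\<Sum>m\<in>{1..n}. real (multiplicity p m))"
  proof (cases "n = 0")
    case False
    have "real n / real p - 1 \<le> real (n div p ^ 1)"
      using divide_nat_diff_div_nat_less_one[of n p] by simp
    also have "\<dots> \<le> (\<Sum>k\<in>{1..n}. real (n div p ^ k))" using False by (intro member_le_sum) auto
    finally show ?thesis using swap by simp
  qed simp
  have "(\<Sum>k\<in>{1..n}. real (n div p ^ k)) \<le> (\<Sum>k\<in>{1..n}. real n * ((1 / real p) ^ k))"
  proof (rule sum_mono)
    fix k
    have "real (n div p ^ k) \<le> real n / real (p ^ k)" by (rule of_nat_div_le_of_nat)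
    then show "real (n div p ^ k) \<le> real n * ((1 / real p) ^ k)" by (simp add: power_one_over)
  qed
  also have "\<dots> = real n * (\<Sum>k\<in>{1..n}. (1 / real p) ^ k)" by (simp add: sum_distrib_left)
  also have "(\<Sum>k\<in>{1..n}. (1 / real p) ^ k) \<le> 1 / (real p - 1)"
  proof -
    have "(real p - 1) * (\<Sum>k\<in>{1..n}. (1 / real p) ^ k) = 1 - (1 / real p) ^ n"
    proof (induction n)
      case (Suc n)
      have "(real p - 1) * (1 / real p) ^ Suc n
          = (real p * (1 / real p)) * (1 / real p) ^ n - (1 / real p) ^ Suc n"
        by (simp only: left_diff_distrib power_Suc mult.assoc mult_1_left)
      also have "real p * (1 / real p) = 1" using p by simp
      finally have "(real p - 1) * (1 / real p) ^ Suc n = (1 / real p) ^ n - (1 / real p) ^ Suc n"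
        by simp
      then show ?case using Suc.IH by (simp add: distrib_left)
    qed simp
    also have "\<dots> \<le> 1" by simp
    finally show ?thesis using p by (simp add: pos_le_divide_eq mult.commute)
  qed
  finally show "(\<Sum>m\<in>{1..n}. real (multiplicity p m)) \<le> real n / (real p - 1)"
    using swap by (simp add: mult_left_mono)
qed

lemma power_over_fact_le_exp: "x ^ k / fact k \<le> exp x" if "x \<ge> 0" for x :: real
proof -
  have "(\<Sum>j\<in>{k}. inverse (fact j) * x ^ j) \<le> (\<Sum>j. inverse (fact j) * x ^ j)"
    using that by (intro sum_le_suminf[OF summable_exp]) auto
  then show ?thesis by (simp add: exp_def scaleR_conv_of_real divide_inverse mult.commute)
qed

text \<open>The lower bound keeps a single term of the exponential series at \<open>n\<close>. An
  error of order \<open>n\<close> is harmless because Mertens' first theorem divides it by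
  \<open>n\<close>.\<close>

lemma ln_fact_bounds:
  assumes "n > 0"
  shows "real n * ln (real n) - real n \<le> ln (fact n)" and "ln (fact n) \<le> real n * ln (real n)"
proof -
  have "real n ^ n / fact n \<le> exp (real n)" by (rule power_over_fact_le_exp) simp
  then have "ln (real n ^ n / fact n) \<le> real n"
    using assms by (metis divide_pos_pos exp_gt_zero fact_gt_zero ln_exp ln_le_cancel_iff of_nat_0_less_iff zero_less_power)
  then show "real n * ln (real n) - real n \<le> ln (fact n)"
    using assms by (simp add: ln_div ln_realpow)
  have "fact n \<le> (real n) ^ n" using fact_le_power[of n, where 'a = real] by simp
  then have "ln (fact n) \<le> ln (real n ^ n)" using assms by (subst ln_le_cancel_iff) auto
  then show "ln (fact n) \<le> real n * ln (real n)" using assms by (simp add: ln_realpow)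
qed

text \<open>ln (n!) is n ln n + O(n), and it is also the sum of the exponents in n! times ln p. The
  lower bounds for the exponents leave the Chebyshev sum as error, which is O(n); the upper bounds
  leave \<open>n\<close> times a convergent series.\<close>

lemma mertens_first:
  obtains C where "\<And>n. n \<ge> 1 \<Longrightarrow> \<bar>(\<Sum>p\<in>primes_upto n. ln (real p) / real p) - ln (real n)\<bar> \<le> C"
proof -
  \<comment> \<open>The term is the excess of ln m / (m - 1) over ln m / m. Summing over all
    integers bounds the sum over primes; at m = 0 and m = 1 the denominator is 0 and hence so is the
    term.\<close>
  have summ: "summable (\<lambda>m::nat. ln (real m) / (real m * (real m - 1)))"
  proof (rule summable_comparison_test_bigo)
    show "summable (\<lambda>m::nat. norm (real m powr (-3/2)))" by (simp add: summable_real_powr_iff)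
    show "(\<lambda>m::nat. ln (real m) / (real m * (real m - 1))) \<in> O(\<lambda>m. real m powr (-3/2))"
      by real_asymp
  qed
  define S where "S = (\<Sum>m::nat. ln (real m) / (real m * (real m - 1)))"
  have S: "(\<Sum>p\<in>primes_upto n. ln (real p) / (real p * (real p - 1))) \<le> S" for n
    unfolding S_def
  proof (rule sum_le_suminf[OF summ])
    show "0 \<le> ln (real m) / (real m * (real m - 1))" for m
      by (cases "m = 0") (auto intro!: divide_nonneg_nonneg mult_nonneg_nonneg)
  qed auto
  have main: "\<bar>(\<Sum>p\<in>primes_upto n. ln (real p) / real p) - ln (real n)\<bar> \<le> 1 + S + 4 * ln 2"
    if n: "n \<ge> 1" for n
  proof -
    let ?M = "\<lambda>p. \<Sum>m\<in>{1..n}. real (multiplicity p m)"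
    have "ln (fact n) = (\<Sum>m\<in>{1..n}. ln (real m))"
      unfolding fact_prod of_nat_prod by (rule ln_prod) auto
    also have "\<dots> = (\<Sum>m\<in>{1..n}. \<Sum>p\<in>primes_upto n. real (multiplicity p m) * ln (real p))"
      by (intro sum.cong refl ln_eq_sum_multiplicity) auto
    also have "\<dots> = (\<Sum>p\<in>primes_upto n. ?M p * ln (real p))"
      by (subst sum.swap) (simp add: sum_distrib_right)
    finally have fact: "ln (fact n) = (\<Sum>p\<in>primes_upto n. ?M p * ln (real p))" .
    have "(\<Sum>p\<in>primes_upto n. (real n / real p - 1) * ln (real p)) \<le> ln (fact n)" unfolding fact
      by (intro sum_mono mult_right_mono sum_multiplicity_bounds) (auto simp: primes_upto_def ln_prime_nonneg)
    also have "(\<Sum>p\<in>primes_upto n. (real n / real p - 1) * ln (real p)) =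
        real n * (\<Sum>p\<in>primes_upto n. ln (real p) / real p) - (\<Sum>p\<in>primes_upto n. ln (real p))"
      by (simp add: sum_distrib_left sum_subtractf algebra_simps)
    finally have "real n * (\<Sum>p\<in>primes_upto n. ln (real p) / real p) \<le> real n * (ln (real n) + 4 * ln 2)"
      using chebyshev_theta_upper[of n] ln_fact_bounds(2)[of n] n by (simp add: algebra_simps)
    then have upper: "(\<Sum>p\<in>primes_upto n. ln (real p) / real p) \<le> ln (real n) + 4 * ln 2"
      using n by (subst (asm) mult_le_cancel_left_pos) auto
    have "ln (fact n) \<le> (\<Sum>p\<in>primes_upto n. real n / (real p - 1) * ln (real p))" unfolding fact
      by (intro sum_mono mult_right_mono sum_multiplicity_bounds) (auto simp: primes_upto_def ln_prime_nonneg)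
    also have "\<dots> = (\<Sum>p\<in>primes_upto n. real n * (ln (real p) / real p + ln (real p) / (real p * (real p - 1))))"
    proof (intro sum.cong refl)
      fix p assume "p \<in> primes_upto n"
      then have "p > 1" using prime_gt_1_nat[of p] by (simp add: primes_upto_def)
      then have "real p > 1" by simp
      then show "real n / (real p - 1) * ln (real p) =
          real n * (ln (real p) / real p + ln (real p) / (real p * (real p - 1)))"
        by (simp add: divide_simps) (simp add: algebra_simps)
    qed
    also have "\<dots> \<le> real n * ((\<Sum>p\<in>primes_upto n. ln (real p) / real p) + S)"
      using S[of n] by (simp add: sum_distrib_left[symmetric] sum.distrib mult_left_mono)
    finally have "real n * (ln (real n) - 1) \<le> real n * ((\<Sum>p\<in>primes_upto n. ln (real p) / real p) + S)"
      using ln_fact_bounds(1)[of n] n by (simp add: algebra_simps)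
    then have "ln (real n) - 1 \<le> (\<Sum>p\<in>primes_upto n. ln (real p) / real p) + S"
      using n by (subst (asm) mult_le_cancel_left_pos) auto
    moreover have "0 \<le> S" using S[of 0] by (simp add: primes_upto_def)
    moreover have "(0::real) \<le> ln 2" by simp
    ultimately show ?thesis using upper unfolding abs_le_iff by linarith
  qed
  show ?thesis using that main by blast
qed

text \<open>Abel summation of \<open>A(n) = ln n + O(1)\<close> against \<open>1 / ln n\<close>; the resulting sum of
  \<open>(ln (k+1) - ln k) / ln (k+1)\<close> is compared with the telescoping sum of
  \<open>ln (ln (k+1)) - ln (ln k)\<close>.\<close>

lemma mertens_second:
  obtains C where "\<And>n. n \<ge> 2 \<Longrightarrow> \<bar>(\<Sum>p\<in>primes_upto n. 1 / real p) - ln (ln (real n))\<bar> \<le> C"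
proof -
  obtain C where C: "\<And>n. n \<ge> 1 \<Longrightarrow> \<bar>(\<Sum>p\<in>primes_upto n. ln (real p) / real p) - ln (real n)\<bar> \<le> C"
    using mertens_first by blast
  define A where "A = (\<lambda>n. \<Sum>p\<in>primes_upto n. ln (real p) / real p)"
  define B where "B = (\<lambda>n. \<Sum>p\<in>primes_upto n. 1 / real p)"
  define l where "l = (\<lambda>k. ln (real k))"
  have lpos: "l k > 0" if "k \<ge> 2" for k using that by (simp add: l_def)
  have lmono: "l k \<le> l (Suc k)" if "k \<ge> 2" for k using that by (simp add: l_def)
  have lstep: "l (Suc k) - l k \<le> 1" if "k \<ge> 2" for k
  proof -
    have "l (Suc k) - l k = ln (1 + 1 / real k)"
    proof -
      have "1 + 1 / real k = real (Suc k) / real k" using that by (simp add: field_simps)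
      then show ?thesis using that by (simp add: l_def ln_div)
    qed
    also have "\<dots> \<le> 1 / real k" by (rule ln_add_one_self_le_self) auto
    also have "\<dots> \<le> 1" using that by simp
    finally show ?thesis .
  qed
  \<comment> \<open>A prime \<open>Suc k\<close> raises \<open>B\<close> by exactly as much as it
    raises \<open>A\<close> divided by \<open>l (Suc k)\<close>. With this weight held fixed nothing
    changes, so only the passage from 1 / l k to 1 / l (Suc k) contributes.\<close>
  have step: "B (Suc k) - A (Suc k) / l (Suc k) = B k - A k / l (Suc k)" if "k \<ge> 2" for k
  proof (cases "prime (Suc k)")
    case True
    then have "primes_upto (Suc k) = insert (Suc k) (primes_upto k)" "Suc k \<notin> primes_upto k"
      by (auto simp: primes_upto_def le_Suc_eq)
    then have "A (Suc k) = l (Suc k) / real (Suc k) + A k" "B (Suc k) = 1 / real (Suc k) + B k"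
      by (simp_all add: A_def B_def l_def)
    moreover have "(l (Suc k) / real (Suc k)) / l (Suc k) = 1 / real (Suc k)"
      using lpos[of "Suc k"] that by simp
    ultimately show ?thesis by (simp add: add_divide_distrib)
  next
    case False
    then have "primes_upto (Suc k) = primes_upto k"
      by (auto simp: primes_upto_def le_Suc_eq)
    then show ?thesis by (simp add: A_def B_def)
  qed
  define D where "D = \<bar>B 2\<bar> + \<bar>A 2 / l 2\<bar> + \<bar>ln (l 2)\<bar> + (C + 1) / l 2"
  have C0: "C \<ge> 0" using C[of 1] by linarith
  have l_ln: "(l (Suc k) - l k) / l (Suc k) \<le> ln (l (Suc k)) - ln (l k)"
             "ln (l (Suc k)) - ln (l k) \<le> (l (Suc k) - l k) / l k" if "k \<ge> 2" for k
  proof -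
    have pos: "l k > 0" "l (Suc k) > 0" using lpos that by auto
    have "ln (l k / l (Suc k)) \<le> l k / l (Suc k) - 1" using pos by (intro ln_le_minus_one) auto
    then show "(l (Suc k) - l k) / l (Suc k) \<le> ln (l (Suc k)) - ln (l k)"
      using pos by (simp add: ln_div diff_divide_distrib)
    have "ln (l (Suc k) / l k) \<le> l (Suc k) / l k - 1" using pos by (intro ln_le_minus_one) auto
    then show "ln (l (Suc k)) - ln (l k) \<le> (l (Suc k) - l k) / l k"
      using pos by (simp add: ln_div diff_divide_distrib)
  qed
  \<comment> \<open>The error of each step is at most C + 1 times the decrement \<open>r\<close> of
    1 / l, and these decrements telescope. The share C comes from \<bar>A k - l k\<bar> \<le> C, the
    share 1 from \<open>lstep\<close>.\<close>
  have key: "\<bar>(B n - A n / l n) - ln (l n) - (B 2 - A 2 / l 2 - ln (l 2))\<bar> \<le> (C + 1) * (1 / l 2 - 1 / l n)"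
    if "n \<ge> 2" for n
    using that
  proof (induction n rule: dec_induct)
    case base
    then show ?case by simp
  next
    case (step k)
    have k: "k \<ge> 2" using step by simp
    have pos: "l k > 0" "l (Suc k) > 0" using lpos k by auto
    define r where "r = 1 / l k - 1 / l (Suc k)"
    have r: "r \<ge> 0" using lmono[OF k] pos by (simp add: r_def frac_le)
    have Ak: "\<bar>A k - l k\<bar> \<le> C" using C[of k] k by (simp add: A_def l_def)
    have "(B (Suc k) - A (Suc k) / l (Suc k)) - (B k - A k / l k) = A k * r"
      using \<open>\<And>k. 2 \<le> k \<Longrightarrow> B (Suc k) - A (Suc k) / l (Suc k) = B k - A k / l (Suc k)\<close>[OF k]
      by (simp add: r_def algebra_simps)
    also have "\<dots> = (A k - l k) * r + l k * r" by (simp add: algebra_simps)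
    also have "l k * r = (l (Suc k) - l k) / l (Suc k)" using pos by (simp add: r_def field_simps)
    finally have eq: "(B (Suc k) - A (Suc k) / l (Suc k)) - (B k - A k / l k)
        = (A k - l k) * r + (l (Suc k) - l k) / l (Suc k)" .
    have 1: "\<bar>(A k - l k) * r\<bar> \<le> C * r" using Ak r by (simp add: abs_mult mult_right_mono)
    have "(l (Suc k) - l k) / l k - (l (Suc k) - l k) / l (Suc k) = (l (Suc k) - l k) * r"
      by (simp only: r_def right_diff_distrib times_divide_eq_right mult_1_right)
    also have "\<dots> \<le> 1 * r" using lstep[OF k] r by (intro mult_right_mono) auto
    finally have 2: "\<bar>(l (Suc k) - l k) / l (Suc k) - (ln (l (Suc k)) - ln (l k))\<bar> \<le> r"
      using l_ln[OF k] by (simp add: abs_le_iff)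
    have 3: "(C + 1) * (1 / l 2 - 1 / l (Suc k)) = (C + 1) * (1 / l 2 - 1 / l k) + C * r + r"
      unfolding r_def by algebra
    show ?case using step.IH eq 1 2 3 unfolding abs_le_iff by linarith
  qed
  have "\<bar>B n - ln (ln (real n))\<bar> \<le> D + 1 + C / l 2" if n: "n \<ge> 2" for n
  proof -
    have pos: "l n > 0" "l 2 > 0" using lpos n by auto
    have "\<bar>A n / l n - 1\<bar> = \<bar>A n - l n\<bar> / l n" using pos by (simp add: field_simps)
    also have "\<dots> \<le> C / l 2" using C[of n] n pos C0
      by (intro frac_le) (auto simp: A_def l_def)
    finally have 1: "\<bar>A n / l n - 1\<bar> \<le> C / l 2" .
    have 2: "(C + 1) * (1 / l 2 - 1 / l n) \<le> (C + 1) / l 2"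
      using pos C0 by (simp add: algebra_simps)
    have "ln (ln (real n)) = ln (l n)" by (simp add: l_def)
    then show ?thesis using key[OF n] 1 2 unfolding D_def abs_le_iff by linarith
  qed
  then show ?thesis using that B_def by blast
qed

section \<open>Comparison with independent variables\<close>

lemma prod_primes_dvd_iff:
  fixes m :: nat
  assumes "finite B" "\<And>p. p \<in> B \<Longrightarrow> prime p"
  shows "\<Prod>B dvd m \<longleftrightarrow> (\<forall>p\<in>B. p dvd m)"
  using assms
proof (induction B rule: finite_induct)
  case (insert p B)
  have "coprime p (\<Prod>B)"
    using insert.hyps insert.prems by (intro prod_coprime_right) (metis insert_iff primes_coprime)
  then have "p * \<Prod>B dvd m \<longleftrightarrow> p dvd m \<and> \<Prod>B dvd m"
    by (meson divides_mult dvd_mult_left dvd_mult_right)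
  then show ?case using insert by simp
qed simp

text \<open>
  The probabilistic model: a random subset of \<open>P\<close> that contains each \<open>p\<close> independently with
  probability \<open>1 / p\<close>. It is compared with the set of the prime divisors in \<open>P\<close> of a uniformly
  random \<open>m \<le> n\<close>.
\<close>

definition model_mean :: "nat set \<Rightarrow> (nat set \<Rightarrow> 'a::real_vector) \<Rightarrow> 'a"
  where "model_mean P F = (\<Sum>A\<in>Pow P. ((\<Prod>p\<in>A. 1 / real p) * (\<Prod>p\<in>P - A. 1 - 1 / real p)) *\<^sub>R F A)"

definition divisors_mean :: "nat \<Rightarrow> nat set \<Rightarrow> (nat set \<Rightarrow> 'a::real_vector) \<Rightarrow> 'a"
  where "divisors_mean n P F = (1 / real n) *\<^sub>R (\<Sum>m\<in>{1..n}. F {p \<in> P. p dvd m})"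

text \<open>The mean of \<open>card A\<close> in the model, hence the centring used throughout; for
  all primes up to \<open>n\<close> it is the sum in Mertens' second theorem.\<close>

definition recip_sum :: "nat set \<Rightarrow> real"
  where "recip_sum P = (\<Sum>p\<in>P. 1 / real p)"

text \<open>Independence in algebraic form: multiplying out a product of two-term sums over
  \<open>P\<close> chooses a subset \<open>A\<close> of factors that contribute the first
  term.\<close>

lemma model_mean_prod:
  fixes a b :: "nat \<Rightarrow> 'a::real_normed_field"
  assumes "finite P"
  shows "model_mean P (\<lambda>A. (\<Prod>p\<in>A. a p) * (\<Prod>p\<in>P - A. b p)) =
    (\<Prod>p\<in>P. (1 / real p) *\<^sub>R a p + (1 - 1 / real p) *\<^sub>R b p)"
  unfolding prod_add[OF assms] model_mean_def
  by (intro sum.cong refl)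
     (simp add: scaleR_conv_of_real prod.distrib prod_dividef mult_ac)

lemma model_mean_cong: "(\<And>A. A \<subseteq> P \<Longrightarrow> F A = G A) \<Longrightarrow> model_mean P F = model_mean P G"
  unfolding model_mean_def by (intro sum.cong) auto

lemma model_mean_linear:
  "model_mean P (\<lambda>A. F A + G A) = model_mean P F + model_mean P G"
  "model_mean P (\<lambda>A. F A - G A) = model_mean P F - model_mean P G"
  "model_mean P (\<lambda>A. c *\<^sub>R F A) = c *\<^sub>R model_mean P F"
  "model_mean P (\<lambda>A. \<Sum>i\<in>I. H i A) = (\<Sum>i\<in>I. model_mean P (H i))"
  unfolding model_mean_def
  by (simp_all add: scaleR_add_right scaleR_diff_right sum.distrib sum_subtractf scaleR_sum_right
      mult.commute sum.swap[of _ I])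

lemma divisors_mean_cong:
  "(\<And>A. A \<subseteq> P \<Longrightarrow> F A = G A) \<Longrightarrow> divisors_mean n P F = divisors_mean n P G"
  unfolding divisors_mean_def by (intro arg_cong2[where f = scaleR] sum.cong) auto

lemma divisors_mean_linear:
  "divisors_mean n P (\<lambda>A. F A + G A) = divisors_mean n P F + divisors_mean n P G"
  "divisors_mean n P (\<lambda>A. F A - G A) = divisors_mean n P F - divisors_mean n P G"
  "divisors_mean n P (\<lambda>A. c *\<^sub>R F A) = c *\<^sub>R divisors_mean n P F"
  "divisors_mean n P (\<lambda>A. \<Sum>i\<in>I. H i A) = (\<Sum>i\<in>I. divisors_mean n P (H i))"
  unfolding divisors_mean_def
  by (simp_all add: scaleR_add_right scaleR_diff_right sum.distrib sum_subtractf scaleR_sum_right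
      mult.commute sum.swap[of _ I])

lemma model_mean_mono:
  assumes "\<And>p. p \<in> P \<Longrightarrow> prime p" "\<And>A. A \<subseteq> P \<Longrightarrow> F A \<le> (G A :: real)"
  shows "model_mean P F \<le> model_mean P G"
  unfolding model_mean_def
  by (intro sum_mono scaleR_left_mono assms(2) mult_nonneg_nonneg prod_nonneg)
     (auto dest!: assms(1) prime_ge_1_nat)

lemma norm_model_mean_le:
  fixes F :: "nat set \<Rightarrow> 'a::real_normed_vector"
  assumes "\<And>p. p \<in> P \<Longrightarrow> prime p"
  shows "norm (model_mean P F) \<le> model_mean P (\<lambda>A. norm (F A))"
proof -
  have nonneg: "0 \<le> (\<Prod>p\<in>A. 1 / real p) * (\<Prod>p\<in>P - A. 1 - 1 / real p)" if "A \<subseteq> P" for A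
    by (intro mult_nonneg_nonneg prod_nonneg) (use that in \<open>auto dest!: assms prime_ge_1_nat\<close>)
  have "norm (model_mean P F) \<le>
      (\<Sum>A\<in>Pow P. norm (((\<Prod>p\<in>A. 1 / real p) * (\<Prod>p\<in>P - A. 1 - 1 / real p)) *\<^sub>R F A))"
    unfolding model_mean_def by (rule norm_sum)
  also have "\<dots> = model_mean P (\<lambda>A. norm (F A))"
    unfolding model_mean_def norm_scaleR real_scaleR_def
    by (intro sum.cong refl arg_cong2[where f = times] abs_of_nonneg nonneg) auto
  finally show ?thesis .
qed

lemma norm_divisors_mean_le:
  fixes F :: "nat set \<Rightarrow> 'a::real_normed_vector"
  shows "norm (divisors_mean n P F) \<le> divisors_mean n P (\<lambda>A. norm (F A))"
  unfolding divisors_mean_def norm_scaleR real_scaleR_def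
  by (intro mult_mono norm_sum) (auto intro: sum_nonneg)

lemma divisors_mean_mono:
  "(\<And>A. A \<subseteq> P \<Longrightarrow> F A \<le> (G A :: real)) \<Longrightarrow> divisors_mean n P F \<le> divisors_mean n P G"
  unfolding divisors_mean_def by (intro scaleR_left_mono sum_mono) auto

text \<open>\<open>B \<subseteq> A\<close> says that no element outside \<open>A\<close> lies in
  \<open>B\<close>. Its indicator is thus a product over \<open>P - A\<close>, to which
  \<open>model_mean_prod\<close> applies.\<close>

lemma model_mean_superset:
  assumes "finite P" "B \<subseteq> P" "\<And>p. p \<in> P \<Longrightarrow> prime p"
  shows "model_mean P (\<lambda>A. of_bool (B \<subseteq> A)) = 1 / real (\<Prod>B)"
proof -
  have fin: "finite B" using assms finite_subset by blast
  have "model_mean P (\<lambda>A. of_bool (B \<subseteq> A) :: real) =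
      model_mean P (\<lambda>A. (\<Prod>p\<in>A. 1) * (\<Prod>p\<in>P - A. of_bool (p \<notin> B)))"
  proof (rule model_mean_cong)
    fix A assume "A \<subseteq> P"
    have "(\<Prod>p\<in>P - A. of_bool (p \<notin> B) :: real) = of_bool (B \<subseteq> A)"
    proof (cases "B \<subseteq> A")
      case True
      then show ?thesis by (auto intro!: prod.neutral)
    next
      case False
      then have "\<exists>p\<in>P - A. of_bool (p \<notin> B) = (0::real)" using assms(2) by auto
      then have "(\<Prod>p\<in>P - A. of_bool (p \<notin> B) :: real) = 0" using assms(1) by (intro prod_zero) auto
      then show ?thesis using False by simp
    qed
    then show "of_bool (B \<subseteq> A) = (\<Prod>p\<in>A. 1) * (\<Prod>p\<in>P - A. of_bool (p \<notin> B) :: real)" by simp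
  qed
  also have "\<dots> = (\<Prod>p\<in>P. if p \<in> B then 1 / real p else 1)"
    unfolding model_mean_prod[OF assms(1)] by (intro prod.cong) auto
  also have "\<dots> = (\<Prod>p\<in>B. 1 / real p)"
    using assms(1,2) by (simp add: prod.If_cases Int_absorb1)
  also have "\<dots> = 1 / real (\<Prod>B)" by (simp add: prod_dividef)
  finally show ?thesis .
qed

text \<open>The indicator of \<open>B \<subseteq> A\<close> is there for the induction:
  \<open>card A\<close> is the sum of the indicators of \<open>p \<in> A\<close>, and multiplying by
  one of them replaces \<open>B\<close> by \<open>insert p B\<close>, also when p already lies in
  \<open>B\<close>. One more factor \<open>card A - c\<close> therefore multiplies the error by at
  most \<open>card P + \<bar>c\<bar>\<close>. The base case is the loss of less than 1 in
  \<open>n div \<Prod>B\<close>.\<close>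

lemma moments_close:
  fixes c :: real
  assumes "finite P" "\<And>p. p \<in> P \<Longrightarrow> prime p" "n > 0" "B \<subseteq> P"
  defines "h \<equiv> \<lambda>k B A. of_bool (B \<subseteq> A) * (real (card A) - c) ^ k"
  shows "\<bar>divisors_mean n P (h k B) - model_mean P (h k B)\<bar> \<le> (real (card P) + \<bar>c\<bar>) ^ k / real n"
  using assms(4)
proof (induction k arbitrary: B)
  case 0
  have fin: "finite B" using 0 assms finite_subset by blast
  have pr: "\<And>p. p \<in> B \<Longrightarrow> prime p" using 0 assms by auto
  have pos: "\<Prod>B > 0" using pr by (intro prod_pos) (auto intro: prime_gt_0_nat)
  have "divisors_mean n P (h 0 B) = (1 / real n) * (\<Sum>m\<in>{1..n}. of_bool (\<Prod>B dvd m))"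
    unfolding divisors_mean_def h_def real_scaleR_def using 0
    by (intro arg_cong2[where f = times] sum.cong refl)
       (auto simp: prod_primes_dvd_iff[OF fin pr] subset_eq of_bool_def)
  also have "(\<Sum>m\<in>{1..n}. of_bool (\<Prod>B dvd m) :: real) = real (card {m \<in> {1..n}. \<Prod>B dvd m})"
    by (subst sum_of_bool_eq) (auto intro!: arg_cong[where f = card])
  also have "\<dots> = real (n div \<Prod>B)" using card_multiples_upto[OF pos] by simp
  finally have 1: "divisors_mean n P (h 0 B) = real (n div \<Prod>B) / real n" by simp
  have 2: "model_mean P (h 0 B) = 1 / real (\<Prod>B)"
    using model_mean_superset[OF assms(1) 0 assms(2)] by (simp add: h_def)
  have "\<bar>real (n div \<Prod>B) - real n / real (\<Prod>B)\<bar> \<le> 1"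
    using of_nat_div_le_of_nat[of n "\<Prod>B", where 'a = real] divide_nat_diff_div_nat_less_one[of n "\<Prod>B"]
    by linarith
  then have "\<bar>real (n div \<Prod>B) - real n / real (\<Prod>B)\<bar> / real n \<le> 1 / real n"
    by (intro divide_right_mono) auto
  also have "\<bar>real (n div \<Prod>B) - real n / real (\<Prod>B)\<bar> / real n =
      \<bar>(real (n div \<Prod>B) - real n / real (\<Prod>B)) / real n\<bar>" by simp
  also have "(real (n div \<Prod>B) - real n / real (\<Prod>B)) / real n = real (n div \<Prod>B) / real n - 1 / real (\<Prod>B)"
    using assms(3) by (simp only: diff_divide_distrib) simp
  finally show ?case unfolding 1 2 by simp
next
  case (Suc k)
  define M where "M = (real (card P) + \<bar>c\<bar>) ^ k / real n"
  define L where "L = (\<lambda>F. divisors_mean n P F - model_mean P F :: real)"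
  have step: "h (Suc k) B A = (\<Sum>p\<in>P. h k (insert p B) A) - c *\<^sub>R h k B A" if "A \<subseteq> P" for A
  proof -
    have "(\<Sum>p\<in>P. h k (insert p B) A) = (\<Sum>p\<in>P. of_bool (p \<in> A)) * h k B A"
      by (simp add: h_def sum_distrib_right sum_distrib_left of_bool_conj mult_ac)
    also have "(\<Sum>p\<in>P. of_bool (p \<in> A) :: real) = real (card A)"
      using assms(1) that by (simp add: of_bool_def sum.If_cases Int_absorb1)
    finally show ?thesis by (simp add: h_def algebra_simps)
  qed
  have "divisors_mean n P (h (Suc k) B) =
      (\<Sum>p\<in>P. divisors_mean n P (h k (insert p B))) - c *\<^sub>R divisors_mean n P (h k B)"
    unfolding divisors_mean_linear[symmetric] by (rule divisors_mean_cong) (rule step)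
  moreover have "model_mean P (h (Suc k) B) =
      (\<Sum>p\<in>P. model_mean P (h k (insert p B))) - c *\<^sub>R model_mean P (h k B)"
    unfolding model_mean_linear[symmetric] by (rule model_mean_cong) (rule step)
  ultimately have "L (h (Suc k) B) = (\<Sum>p\<in>P. L (h k (insert p B))) - c * L (h k B)"
    by (simp add: L_def sum_subtractf right_diff_distrib)
  also have "\<bar>\<dots>\<bar> \<le> (\<Sum>p\<in>P. \<bar>L (h k (insert p B))\<bar>) + \<bar>c\<bar> * \<bar>L (h k B)\<bar>"
    by (rule order_trans[OF abs_triangle_ineq4]) (simp add: abs_mult)
  also have "\<dots> \<le> (\<Sum>p\<in>P. M) + \<bar>c\<bar> * M"
    unfolding L_def M_def using Suc.prems by (intro add_mono sum_mono mult_left_mono Suc.IH) auto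
  also have "\<dots> = (real (card P) + \<bar>c\<bar>) ^ Suc k / real n" by (simp add: M_def distrib_right add_divide_distrib)
  finally show ?case by (simp add: L_def)
qed

section \<open>Exponential moments and characteristic functions of the model\<close>

lemma exp_minus_le: "exp (- x) \<le> 1 - x + x\<^sup>2" if "x \<ge> 0" for x :: real
proof -
  have "exp (- x) = 1 / exp x" by (simp add: exp_minus divide_inverse)
  also have "\<dots> \<le> 1 / (1 + x)" using that exp_ge_add_one_self[of x] by (intro divide_left_mono) auto
  also have "\<dots> \<le> 1 - x + x\<^sup>2"
  proof -
    have "1 \<le> (1 - x + x\<^sup>2) * (1 + x)" using that by (simp add: power2_eq_square algebra_simps)
    then show ?thesis using that by (simp add: pos_divide_le_eq)
  qed
  finally show ?thesis .
qed

lemma exp_le_quadratic: "exp x \<le> 1 + x + x\<^sup>2" if "\<bar>x\<bar> \<le> 1" for x :: real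
  using exp_bound[of x] exp_minus_le[of "- x"] that by (cases "x \<ge> 0") auto

lemma card_minus_recip_sum:
  assumes "finite P" "A \<subseteq> P"
  shows "real (card A) - recip_sum P = (\<Sum>p\<in>A. 1 - 1 / real p) + (\<Sum>p\<in>P - A. - (1 / real p))"
proof -
  have "recip_sum P = (\<Sum>p\<in>A. 1 / real p) + (\<Sum>p\<in>P - A. 1 / real p)"
    unfolding recip_sum_def using assms by (metis add.commute sum.subset_diff)
  then show ?thesis by (simp add: sum_subtractf sum_negf)
qed

text \<open>By independence the mean is a product. The factor at p is (1 + (e^s - 1) / p) e^(-s/p),
  at most exp ((e^s - 1 - s) / p), and e^s - 1 - s \<le> s^2 for \<bar>s\<bar> \<le> 1.\<close>

lemma model_mean_exp_le:
  assumes "finite P" "\<And>p. p \<in> P \<Longrightarrow> prime p" "\<bar>s\<bar> \<le> 1"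
  shows "model_mean P (\<lambda>A. exp (s * (real (card A) - recip_sum P))) \<le> exp (s\<^sup>2 * recip_sum P)"
proof -
  have "model_mean P (\<lambda>A. exp (s * (real (card A) - recip_sum P))) =
      model_mean P (\<lambda>A. (\<Prod>p\<in>A. exp (s * (1 - 1 / real p))) * (\<Prod>p\<in>P - A. exp (- s / real p)))"
    using assms(1)
    by (intro model_mean_cong)
       (simp add: card_minus_recip_sum exp_sum[symmetric] finite_subset distrib_left sum_distrib_left exp_add[symmetric])
  also have "\<dots> = (\<Prod>p\<in>P. (1 / real p) * exp (s * (1 - 1 / real p)) + (1 - 1 / real p) * exp (- s / real p))"
    by (subst model_mean_prod[OF assms(1)]) simp
  also have "\<dots> \<le> (\<Prod>p\<in>P. exp (s\<^sup>2 * (1 / real p)))"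
  proof (rule prod_mono, intro conjI)
    fix p assume "p \<in> P"
    then have p: "real p \<ge> 1" using assms(2) prime_ge_1_nat by fastforce
    then show "0 \<le> (1 / real p) * exp (s * (1 - 1 / real p)) + (1 - 1 / real p) * exp (- s / real p)"
      by (intro add_nonneg_nonneg mult_nonneg_nonneg) auto
    have "exp (s * (1 - 1 / real p)) = exp s * exp (- s / real p)"
      by (simp add: exp_add[symmetric] algebra_simps)
    then have "(1 / real p) * exp (s * (1 - 1 / real p)) + (1 - 1 / real p) * exp (- s / real p) =
        (1 + (exp s - 1) / real p) * exp (- s / real p)"
      by (simp add: algebra_simps add_divide_distrib diff_divide_distrib)
    also have "\<dots> \<le> exp ((exp s - 1) / real p) * exp (- s / real p)"
      by (intro mult_right_mono exp_ge_add_one_self) auto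
    also have "\<dots> = exp ((exp s - 1 - s) / real p)"
      by (simp add: exp_add[symmetric] diff_divide_distrib)
    also have "\<dots> \<le> exp (s\<^sup>2 * (1 / real p))"
      using exp_le_quadratic[OF assms(3)] p by (simp add: divide_right_mono)
    finally show "(1 / real p) * exp (s * (1 - 1 / real p)) + (1 - 1 / real p) * exp (- s / real p)
        \<le> exp (s\<^sup>2 * (1 / real p))" .
  qed
  also have "\<dots> = exp (s\<^sup>2 * recip_sum P)"
    using assms(1) by (simp add: recip_sum_def exp_sum[symmetric] sum_distrib_left)
  finally show ?thesis .
qed

text \<open>
  The Taylor polynomial of degree \<open>N\<close> only involves moments, which nearly agree; the remainder is
  at most the even moment of order \<open>N + 1\<close>, which the exponential moments of the model control.
\<close>

lemma characteristic_functions_close: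
  assumes P: "finite P" "\<And>p. p \<in> P \<Longrightarrow> prime p" and n: "n > 0" and N: "odd N"
    and th: "\<bar>2 * \<theta>\<bar> \<le> 1"
  defines "x \<equiv> \<lambda>A. real (card A) - recip_sum P"
  shows "cmod (divisors_mean n P (\<lambda>A. iexp (\<theta> * x A)) - model_mean P (\<lambda>A. iexp (\<theta> * x A)))
    \<le> real (N + 2) * (1 + (real (card P) + recip_sum P)) ^ Suc N / real n
      + 4 * (1 / 2) ^ Suc N * exp (4 * \<theta>\<^sup>2 * recip_sum P)"
proof -
  define K where "K = 1 + (real (card P) + recip_sum P)"
  have mu: "recip_sum P \<ge> 0" by (simp add: recip_sum_def sum_nonneg)
  have K: "K \<ge> 1" using mu by (simp add: K_def)
  have mom: "\<bar>divisors_mean n P (\<lambda>A. x A ^ k) - model_mean P (\<lambda>A. x A ^ k)\<bar> \<le> K ^ Suc N / real n"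
    if "k \<le> Suc N" for k
  proof -
    have "\<bar>divisors_mean n P (\<lambda>A. x A ^ k) - model_mean P (\<lambda>A. x A ^ k)\<bar> \<le> (K - 1) ^ k / real n"
      using moments_close[OF P n, of "{}" "recip_sum P" k] mu by (simp add: x_def K_def)
    also have "\<dots> \<le> K ^ k / real n" using K by (intro divide_right_mono power_mono) auto
    also have "\<dots> \<le> K ^ Suc N / real n" using K that by (intro divide_right_mono power_increasing) auto
    finally show ?thesis .
  qed
  define T where "T = (\<lambda>A. \<Sum>k\<le>N. (x A ^ k) *\<^sub>R ((\<i> * of_real \<theta>) ^ k / fact k))"
  define R where "R = (\<lambda>A. iexp (\<theta> * x A) - T A)"
  \<comment> \<open>Since \<open>N\<close> is odd, \<open>Suc N\<close> is even and the absolute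
    value in the Taylor remainder disappears: \<open>W\<close> is a multiple of a genuine moment, to
    which \<open>mom\<close> applies.\<close>
  define W where "W = (\<lambda>A. (\<bar>\<theta>\<bar> ^ Suc N / fact (Suc N)) *\<^sub>R (x A ^ Suc N))"
  have RW: "cmod (R A) \<le> W A" for A
  proof -
    have "T A = (\<Sum>k\<le>N. (\<i> * of_real (\<theta> * x A)) ^ k / fact k)"
      unfolding T_def by (intro sum.cong refl) (simp add: scaleR_conv_of_real power_mult_distrib mult_ac)
    then have "cmod (R A) \<le> \<bar>\<theta> * x A\<bar> ^ Suc N / fact (Suc N)"
      unfolding R_def using iexp_approx1[of "\<theta> * x A" N] by simp
    also have "\<bar>\<theta> * x A\<bar> ^ Suc N = \<bar>\<theta>\<bar> ^ Suc N * \<bar>x A\<bar> ^ Suc N"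
      by (simp only: abs_mult power_mult_distrib)
    also have "\<bar>x A\<bar> ^ Suc N = x A ^ Suc N" using N by (intro power_even_abs) simp
    finally show ?thesis by (simp add: W_def)
  qed
  have Wmodel: "model_mean P W \<le> 2 * (1 / 2) ^ Suc N * exp (4 * \<theta>\<^sup>2 * recip_sum P)"
  proof -
    \<comment> \<open>The bound y^k / k! \<le> e^y is used at y = \<bar>2 \<theta> x\<bar> rather
      than at \<bar>\<theta> x\<bar>. The extra factor 2 is what produces (1/2)^(N+1), and it is why
      \<bar>2 \<theta>\<bar> \<le> 1 is assumed.\<close>
    have "model_mean P W \<le> model_mean P (\<lambda>A. (1 / 2) ^ Suc N *\<^sub>R (exp ((2 * \<theta>) * x A) + exp ((- 2 * \<theta>) * x A)))"
    proof (rule model_mean_mono[OF P(2)])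
      fix A
      have "W A = \<bar>\<theta>\<bar> ^ Suc N * \<bar>x A\<bar> ^ Suc N / fact (Suc N)"
        using power_even_abs[of "Suc N" "x A"] N by (simp add: W_def del: power_Suc fact_Suc)
      also have "\<dots> = (1 / 2) ^ Suc N * (\<bar>2 * \<theta> * x A\<bar> ^ Suc N / fact (Suc N))"
        by (simp only: abs_mult power_mult_distrib power_one_over abs_numeral) simp
      also have "\<dots> \<le> (1 / 2) ^ Suc N * exp \<bar>2 * \<theta> * x A\<bar>"
        by (intro mult_left_mono power_over_fact_le_exp) auto
      also have "exp \<bar>2 * \<theta> * x A\<bar> \<le> exp ((2 * \<theta>) * x A) + exp ((- 2 * \<theta>) * x A)"
        by (cases "2 * \<theta> * x A \<ge> 0") (simp_all add: abs_of_nonneg abs_of_neg)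
      finally show "W A \<le> (1 / 2) ^ Suc N *\<^sub>R (exp ((2 * \<theta>) * x A) + exp ((- 2 * \<theta>) * x A))"
        by simp
    qed
    also have "\<dots> = (1 / 2) ^ Suc N * (model_mean P (\<lambda>A. exp ((2 * \<theta>) * x A))
        + model_mean P (\<lambda>A. exp ((- 2 * \<theta>) * x A)))"
      unfolding model_mean_linear unfolding real_scaleR_def ..
    also have "\<dots> \<le> (1 / 2) ^ Suc N * (exp ((2 * \<theta>)\<^sup>2 * recip_sum P) + exp ((- 2 * \<theta>)\<^sup>2 * recip_sum P))"
      unfolding x_def using th by (intro mult_left_mono add_mono model_mean_exp_le P) auto
    finally show ?thesis by (simp add: power_mult_distrib)
  qed
  \<comment> \<open>The remainder on the arithmetic side is controlled through the model, at the
    price of one more moment comparison.\<close>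
  have Wdiv: "divisors_mean n P W \<le> model_mean P W + K ^ Suc N / real n"
  proof -
    have "\<bar>\<theta>\<bar> ^ Suc N / fact (Suc N) \<le> 1 / 1"
      using th by (intro frac_le power_le_one) (auto simp: fact_ge_1 simp del: fact_Suc)
    moreover have "\<bar>divisors_mean n P W - model_mean P W\<bar> = (\<bar>\<theta>\<bar> ^ Suc N / fact (Suc N)) *
        \<bar>divisors_mean n P (\<lambda>A. x A ^ Suc N) - model_mean P (\<lambda>A. x A ^ Suc N)\<bar>"
      unfolding W_def divisors_mean_linear model_mean_linear
      unfolding real_scaleR_def right_diff_distrib[symmetric]
      by (simp add: abs_mult)
    moreover have "(\<bar>\<theta>\<bar> ^ Suc N / fact (Suc N)) *
        \<bar>divisors_mean n P (\<lambda>A. x A ^ Suc N) - model_mean P (\<lambda>A. x A ^ Suc N)\<bar> \<le> 1 / 1 * (K ^ Suc N / real n)"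
      using calculation(1) by (intro mult_mono mom) auto
    ultimately have "\<bar>divisors_mean n P W - model_mean P W\<bar> \<le> 1 / 1 * (K ^ Suc N / real n)"
      by (simp only:)
    then show ?thesis by linarith
  qed
  have Tdiff: "cmod (divisors_mean n P T - model_mean P T) \<le> (N + 1) * (K ^ Suc N / real n)"
  proof -
    have eq: "divisors_mean n P (\<lambda>A. (x A ^ k) *\<^sub>R z) = divisors_mean n P (\<lambda>A. x A ^ k) *\<^sub>R z"
      "model_mean P (\<lambda>A. (x A ^ k) *\<^sub>R z) = model_mean P (\<lambda>A. x A ^ k) *\<^sub>R z" for k and z :: complex
      by (simp_all add: divisors_mean_def model_mean_def scaleR_sum_left scaleR_sum_right sum_divide_distrib)
    have "divisors_mean n P T - model_mean P T = (\<Sum>k\<le>N.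
        (divisors_mean n P (\<lambda>A. x A ^ k) - model_mean P (\<lambda>A. x A ^ k)) *\<^sub>R ((\<i> * of_real \<theta>) ^ k / fact k))"
      unfolding T_def divisors_mean_linear model_mean_linear eq by (simp add: sum_subtractf scaleR_diff_left)
    also have "cmod \<dots> \<le> (\<Sum>k\<le>N. K ^ Suc N / real n)"
    proof (intro order_trans[OF norm_sum] sum_mono)
      fix k assume "k \<in> {..N}"
      have "cmod ((\<i> * of_real \<theta>) ^ k / fact k) = \<bar>\<theta>\<bar> ^ k / fact k"
        by (simp add: norm_divide norm_power norm_mult)
      also have "\<dots> \<le> 1 / 1" using th by (intro frac_le power_le_one) (auto simp: fact_ge_1)
      finally have "cmod ((divisors_mean n P (\<lambda>A. x A ^ k) - model_mean P (\<lambda>A. x A ^ k)) *\<^sub>R ((\<i> * of_real \<theta>) ^ k / fact k))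
        \<le> (K ^ Suc N / real n) * 1"
        unfolding norm_scaleR using mom[of k] \<open>k \<in> {..N}\<close> K by (intro mult_mono) auto
      then show "cmod ((divisors_mean n P (\<lambda>A. x A ^ k) - model_mean P (\<lambda>A. x A ^ k)) *\<^sub>R ((\<i> * of_real \<theta>) ^ k / fact k))
        \<le> K ^ Suc N / real n" by simp
    qed
    finally show ?thesis by simp
  qed
  have "(\<lambda>A. iexp (\<theta> * x A)) = (\<lambda>A. T A + R A)" by (simp add: R_def)
  then have "divisors_mean n P (\<lambda>A. iexp (\<theta> * x A)) - model_mean P (\<lambda>A. iexp (\<theta> * x A)) =
      (divisors_mean n P T - model_mean P T) + (divisors_mean n P R - model_mean P R)"
    by (simp add: divisors_mean_linear model_mean_linear)
  also have "cmod \<dots> \<le> cmod (divisors_mean n P T - model_mean P T) + (cmod (divisors_mean n P R) + cmod (model_mean P R))"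
    by (intro order_trans[OF norm_triangle_ineq] add_left_mono norm_triangle_ineq4)
  also have "cmod (divisors_mean n P R) \<le> divisors_mean n P W"
    by (rule order_trans[OF norm_divisors_mean_le]) (intro divisors_mean_mono RW)
  also have "cmod (model_mean P R) \<le> model_mean P W"
    by (rule order_trans[OF norm_model_mean_le]) (use P in \<open>auto intro!: model_mean_mono RW\<close>)
  finally have "cmod (divisors_mean n P (\<lambda>A. iexp (\<theta> * x A)) - model_mean P (\<lambda>A. iexp (\<theta> * x A)))
      \<le> (N + 1) * (K ^ Suc N / real n) + (divisors_mean n P W + model_mean P W)" using Tdiff by linarith
  \<comment> \<open>N + 1 Taylor coefficients and the comparison of \<open>W\<close> give the factor
    N + 2; \<open>model_mean P W\<close> occurs twice, once through \<open>Wdiv\<close>.\<close>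
  also have "\<dots> \<le> real (N + 2) * (K ^ Suc N / real n) + 2 * (2 * (1 / 2) ^ Suc N * exp (4 * \<theta>\<^sup>2 * recip_sum P))"
  proof -
    have "real (N + 2) * (K ^ Suc N / real n) = real (N + 1) * (K ^ Suc N / real n) + K ^ Suc N / real n"
      by (simp only: of_nat_add distrib_right of_nat_numeral of_nat_1)
    then show ?thesis using Wdiv Wmodel by linarith
  qed
  finally show ?thesis by (simp add: K_def mult.assoc)
qed

text \<open>Lindeberg's comparison: both sides are products of factors of modulus at most 1, so
  their distance is at most the sum of the distances of the factors. At each p the two factors agree
  to second order in \<theta>, since the Gaussian one has the variance of the centred Bernoulli
  variable.\<close>

lemma model_characteristic_function:
  assumes P: "finite P" "\<And>p. p \<in> P \<Longrightarrow> prime p" and th: "\<bar>\<theta>\<bar> \<le> 1"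
  shows "cmod (model_mean P (\<lambda>A. iexp (\<theta> * (real (card A) - recip_sum P)))
      - of_real (exp (- (\<theta>\<^sup>2 / 2 * (\<Sum>p\<in>P. (1 / real p) * (1 - 1 / real p))))))
    \<le> \<bar>\<theta>\<bar> ^ 3 * recip_sum P"
proof -
  define a where "a = (\<lambda>p::nat. (1 / real p) *\<^sub>R iexp (\<theta> * (1 - 1 / real p)) + (1 - 1 / real p) *\<^sub>R iexp (- (\<theta> * (1 / real p))))"
  define b where "b = (\<lambda>p::nat. complex_of_real (exp (- (\<theta>\<^sup>2 / 2 * ((1 / real p) * (1 - 1 / real p))))))"
  have "model_mean P (\<lambda>A. iexp (\<theta> * (real (card A) - recip_sum P))) =
      model_mean P (\<lambda>A. (\<Prod>p\<in>A. iexp (\<theta> * (1 - 1 / real p))) * (\<Prod>p\<in>P - A. iexp (- (\<theta> * (1 / real p)))))"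
  proof (rule model_mean_cong)
    fix A assume A: "A \<subseteq> P"
    then have fin: "finite A" "finite (P - A)" using P finite_subset by auto
    have "\<theta> * (real (card A) - recip_sum P) = (\<Sum>p\<in>A. \<theta> * (1 - 1 / real p)) + (\<Sum>p\<in>P - A. - (\<theta> * (1 / real p)))"
      unfolding card_minus_recip_sum[OF P(1) A] distrib_left sum_distrib_left by simp
    then show "iexp (\<theta> * (real (card A) - recip_sum P)) =
        (\<Prod>p\<in>A. iexp (\<theta> * (1 - 1 / real p))) * (\<Prod>p\<in>P - A. iexp (- (\<theta> * (1 / real p))))"
      using fin by (simp only: of_real_add of_real_sum distrib_left sum_distrib_left exp_add exp_sum)
  qed
  also have "\<dots> = (\<Prod>p\<in>P. a p)" unfolding a_def by (rule model_mean_prod[OF P(1)])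
  finally have model: "model_mean P (\<lambda>A. iexp (\<theta> * (real (card A) - recip_sum P))) = (\<Prod>p\<in>P. a p)" .
  have gauss: "complex_of_real (exp (- (\<theta>\<^sup>2 / 2 * (\<Sum>p\<in>P. (1 / real p) * (1 - 1 / real p))))) = (\<Prod>p\<in>P. b p)"
    unfolding b_def sum_distrib_left sum_negf[symmetric] exp_sum[OF P(1)] of_real_prod ..
  have q: "0 \<le> 1 / real p" "1 / real p \<le> 1" if "p \<in> P" for p
    using P(2)[OF that] prime_ge_1_nat[of p] by auto
  have "cmod ((\<Prod>p\<in>P. a p) - (\<Prod>p\<in>P. b p)) \<le> (\<Sum>p\<in>P. cmod (a p - b p))"
  proof (rule norm_prod_diff)
    fix p assume p: "p \<in> P"
    have "cmod (a p) \<le> \<bar>1 / real p\<bar> * 1 + \<bar>1 - 1 / real p\<bar> * 1"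
      unfolding a_def by (rule order_trans[OF norm_triangle_ineq]) (simp add: norm_exp_i_times del: of_real_diff of_real_minus of_real_mult of_real_divide)
    then show "cmod (a p) \<le> 1" using q[OF p] by simp
    show "cmod (b p) \<le> 1" unfolding b_def using q[OF p] by (simp del: times_divide_eq_left times_divide_eq_right)
  qed
  also have "\<dots> \<le> (\<Sum>p\<in>P. \<bar>\<theta>\<bar> ^ 3 * (1 / real p))"
  proof (rule sum_mono)
    fix p assume p: "p \<in> P"
    define u where "u = 1 / real p"
    have u: "0 \<le> u" "u \<le> 1" using q[OF p] by (simp_all add: u_def)
    define E where "E = (\<lambda>y::real. iexp y - (1 + \<i> * of_real y - of_real (y\<^sup>2 / 2)))"
    have E: "cmod (E y) \<le> \<bar>y\<bar> ^ 3 / 6" for y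
    proof -
      have "(\<Sum>k\<le>2. (\<i> * complex_of_real y) ^ k / fact k) = 1 + \<i> * of_real y - of_real (y\<^sup>2 / 2)"
        by (simp add: numeral_2_eq_2 power2_eq_square algebra_simps)
      then show ?thesis using iexp_approx1[of y 2] by (simp add: E_def numeral_3_eq_3 numeral_2_eq_2 fact_numeral)
    qed
    define v where "v = \<theta>\<^sup>2 / 2 * (u * (1 - u))"
    have v: "0 \<le> v" using u by (simp add: v_def)
    have th2: "\<theta>\<^sup>2 \<le> \<bar>\<theta>\<bar>" using th by (metis abs_ge_zero mult_left_le power2_abs power2_eq_square)
    have th3: "\<bar>\<theta>\<bar> ^ 3 = \<theta>\<^sup>2 * \<bar>\<theta>\<bar>" by (simp add: power3_eq_cube power2_eq_square)
    have "a p = u *\<^sub>R (1 + \<i> * of_real (\<theta> * (1 - u)) - of_real ((\<theta> * (1 - u))\<^sup>2 / 2) + E (\<theta> * (1 - u)))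
        + (1 - u) *\<^sub>R (1 + \<i> * of_real (- (\<theta> * u)) - of_real ((- (\<theta> * u))\<^sup>2 / 2) + E (- (\<theta> * u)))"
      by (simp add: a_def E_def u_def)
    \<comment> \<open>The linear terms cancel because the variable is centred, and u (1 - u)^2 + (1
      - u) u^2 = u (1 - u) collects the quadratic ones into \<open>v\<close>.\<close>
    also have "\<dots> = of_real (1 - v) + (u *\<^sub>R E (\<theta> * (1 - u)) + (1 - u) *\<^sub>R E (- (\<theta> * u)))"
      by (simp add: v_def scaleR_conv_of_real power2_eq_square algebra_simps)
         (simp add: field_simps)
    finally have "a p - b p = of_real (1 - v - exp (- v)) + (u *\<^sub>R E (\<theta> * (1 - u)) + (1 - u) *\<^sub>R E (- (\<theta> * u)))"
      by (simp add: b_def v_def u_def)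
    also have "cmod \<dots> \<le> \<bar>1 - v - exp (- v)\<bar> + (u * cmod (E (\<theta> * (1 - u))) + (1 - u) * cmod (E (- (\<theta> * u))))"
      using u by (intro order_trans[OF norm_triangle_ineq] add_mono order_refl) (auto simp del: of_real_diff)
    also have "\<bar>1 - v - exp (- v)\<bar> \<le> v\<^sup>2"
      using exp_minus_le[OF v] exp_ge_add_one_self[of "- v"] by linarith
    also have "v\<^sup>2 \<le> \<bar>\<theta>\<bar> ^ 3 * u / 4"
    proof -
      have "v \<le> \<theta>\<^sup>2 / 2 * u" unfolding v_def using u by (intro mult_left_mono) (auto simp: mult_left_le)
      moreover have "v \<le> \<bar>\<theta>\<bar> / 2 * 1" unfolding v_def using u th2
        by (intro mult_mono) (auto intro: mult_le_one)
      ultimately have "v * v \<le> (\<theta>\<^sup>2 / 2 * u) * (\<bar>\<theta>\<bar> / 2 * 1)" using u v by (intro mult_mono) auto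
      then show ?thesis by (simp add: power2_eq_square th3 mult_ac)
    qed
    also have "u * cmod (E (\<theta> * (1 - u))) \<le> \<bar>\<theta>\<bar> ^ 3 * u / 6"
    proof -
      have "cmod (E (\<theta> * (1 - u))) \<le> \<bar>\<theta> * (1 - u)\<bar> ^ 3 / 6" by (rule E)
      also have "\<dots> \<le> \<bar>\<theta>\<bar> ^ 3 / 6" using u
        by (intro divide_right_mono power_mono) (auto simp: abs_mult mult_left_le)
      finally have "u * cmod (E (\<theta> * (1 - u))) \<le> u * (\<bar>\<theta>\<bar> ^ 3 / 6)" using u by (intro mult_left_mono)
      then show ?thesis by (simp add: mult_ac)
    qed
    also have "(1 - u) * cmod (E (- (\<theta> * u))) \<le> \<bar>\<theta>\<bar> ^ 3 * u / 6"
    proof -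
      have "(1 - u) * cmod (E (- (\<theta> * u))) \<le> 1 * (\<bar>- (\<theta> * u)\<bar> ^ 3 / 6)"
        using u by (intro mult_mono E) auto
      also have "\<bar>- (\<theta> * u)\<bar> ^ 3 = \<bar>\<theta>\<bar> ^ 3 * u ^ 3" using u by (simp add: abs_mult power_mult_distrib)
      also have "1 * (\<bar>\<theta>\<bar> ^ 3 * u ^ 3 / 6) \<le> \<bar>\<theta>\<bar> ^ 3 * u ^ 1 / 6"
        using u power_decreasing[of 1 3 u] by (auto intro!: mult_left_mono simp del: power_one_right)
      finally show ?thesis by simp
    qed
    finally have "cmod (a p - b p) \<le> \<bar>\<theta>\<bar> ^ 3 * u / 4 + (\<bar>\<theta>\<bar> ^ 3 * u / 6 + \<bar>\<theta>\<bar> ^ 3 * u / 6)" by simp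
    moreover have "0 \<le> \<bar>\<theta>\<bar> ^ 3 * u" using u by simp
    ultimately show "cmod (a p - b p) \<le> \<bar>\<theta>\<bar> ^ 3 * (1 / real p)" unfolding u_def[symmetric] by linarith
  qed
  finally show ?thesis unfolding model gauss by (simp add: recip_sum_def sum_distrib_left)
qed

section \<open>The theorem of Erdos and Kac\<close>

definition cutoff :: "nat \<Rightarrow> nat"
  where "cutoff n = nat \<lfloor>exp (ln (real n) / ell2 n)\<rfloor>"

definition small_primes :: "nat \<Rightarrow> nat set"
  where "small_primes n = primes_upto (cutoff n)"

lemma finite_small_primes [simp, intro]: "finite (small_primes n)"
  by (simp add: small_primes_def)

lemma prime_small_primes: "p \<in> small_primes n \<Longrightarrow> prime p"
  by (simp add: small_primes_def primes_upto_def)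

lemma real_cutoff: "real (cutoff n) = real_of_int \<lfloor>exp (ln (real n) / ln (ln (real n)))\<rfloor>"
  by (simp add: cutoff_def ell2_def)

lemma cutoff_le: "real (cutoff n) \<le> exp (ln (real n) / ell2 n)"
  unfolding real_cutoff ell2_def by (rule of_int_floor_le)

lemma ell2_at_top: "filterlim ell2 at_top sequentially"
  unfolding ell2_def by real_asymp

lemma recip_sum_nonneg: "0 \<le> recip_sum P"
  by (simp add: recip_sum_def sum_nonneg)

text \<open>Mertens' second theorem at \<open>cutoff n\<close> and at \<open>n\<close> leaves
  bounded errors, and ln (ln (cutoff n)) - ell2 n is about - ln (ell2 n); all of it vanishes against
  sqrt (ell2 n). The second limit later bounds the mean number of discarded prime divisors.\<close>

lemma recip_sum_small_primes_asymp:
  "(\<lambda>n. (recip_sum (small_primes n) - ell2 n) / sqrt (ell2 n)) \<longlonglongrightarrow> 0"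
  "(\<lambda>n. (recip_sum (primes_upto n) - recip_sum (small_primes n)) / sqrt (ell2 n)) \<longlonglongrightarrow> 0"
proof -
  obtain C where C: "\<And>n. n \<ge> 2 \<Longrightarrow> \<bar>recip_sum (primes_upto n) - ln (ln (real n))\<bar> \<le> C"
    using mertens_second unfolding recip_sum_def by blast
  have small: "(\<lambda>n. r n / sqrt (ell2 n)) \<longlonglongrightarrow> 0" if "eventually (\<lambda>n. \<bar>r n\<bar> \<le> C) sequentially" for r
  proof (rule Lim_null_comparison)
    have "eventually (\<lambda>n. ell2 n > 0) sequentially" unfolding ell2_def by real_asymp
    then show "\<forall>\<^sub>F n in sequentially. norm (r n / sqrt (ell2 n)) \<le> C / sqrt (ell2 n)"
      using that by eventually_elim (simp add: divide_right_mono)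
    show "(\<lambda>n. C / sqrt (ell2 n)) \<longlonglongrightarrow> 0" unfolding ell2_def by real_asymp
  qed
  have ev: "eventually (\<lambda>n. cutoff n \<ge> 2) sequentially"
  proof -
    have "eventually (\<lambda>n. real_of_int \<lfloor>exp (ln (real n) / ln (ln (real n)))\<rfloor> \<ge> 2) sequentially"
      by real_asymp
    then show ?thesis unfolding real_cutoff[symmetric] by eventually_elim simp
  qed
  have "(\<lambda>n. (recip_sum (small_primes n) - ln (ln (real (cutoff n)))) / sqrt (ell2 n)) \<longlonglongrightarrow> 0"
    by (rule small, use ev in eventually_elim) (auto simp: small_primes_def intro: C)
  moreover have "(\<lambda>n. (ln (ln (real (cutoff n))) - ell2 n) / sqrt (ell2 n)) \<longlonglongrightarrow> 0"
    unfolding real_cutoff ell2_def by real_asymp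
  ultimately have "(\<lambda>n. (recip_sum (small_primes n) - ln (ln (real (cutoff n)))) / sqrt (ell2 n)
      + (ln (ln (real (cutoff n))) - ell2 n) / sqrt (ell2 n)) \<longlonglongrightarrow> 0 + 0" by (rule tendsto_add)
  then show 1: "(\<lambda>n. (recip_sum (small_primes n) - ell2 n) / sqrt (ell2 n)) \<longlonglongrightarrow> 0"
    by (simp add: add_divide_distrib[symmetric])
  have "(\<lambda>n. (recip_sum (primes_upto n) - ell2 n) / sqrt (ell2 n)) \<longlonglongrightarrow> 0"
    by (rule small, use eventually_ge_at_top[of 2] in eventually_elim) (auto simp: ell2_def intro: C)
  from tendsto_diff[OF this 1]
  show "(\<lambda>n. (recip_sum (primes_upto n) - recip_sum (small_primes n)) / sqrt (ell2 n)) \<longlonglongrightarrow> 0"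
    by (simp add: diff_divide_distrib[symmetric])
qed

lemma recip_sum_small_primes_ratio: "(\<lambda>n. recip_sum (small_primes n) / ell2 n) \<longlonglongrightarrow> 1"
proof -
  have "(\<lambda>n. 1 / sqrt (ell2 n)) \<longlonglongrightarrow> 0" unfolding ell2_def by real_asymp
  from tendsto_add[OF tendsto_mult[OF recip_sum_small_primes_asymp(1) this] tendsto_const[of 1]]
  have "(\<lambda>n. (recip_sum (small_primes n) - ell2 n) / sqrt (ell2 n) * (1 / sqrt (ell2 n)) + 1) \<longlonglongrightarrow> 1" by simp
  then show ?thesis
  proof (rule Lim_transform_eventually)
    have "eventually (\<lambda>n. ell2 n > 0) sequentially" unfolding ell2_def by real_asymp
    then show "\<forall>\<^sub>F n in sequentially. (recip_sum (small_primes n) - ell2 n) / sqrt (ell2 n) * (1 / sqrt (ell2 n)) + 1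
        = recip_sum (small_primes n) / ell2 n"
      by eventually_elim (simp add: diff_divide_distrib)
  qed
qed

text \<open>The variance falls short of the mean by the sum of 1 / p^2, which is bounded.\<close>

lemma variance_small_primes_ratio:
  "(\<lambda>n. (\<Sum>p\<in>small_primes n. (1 / real p) * (1 - 1 / real p)) / ell2 n) \<longlonglongrightarrow> 1"
proof -
  have summ: "summable (\<lambda>k::nat. (1 / real k)\<^sup>2)"
    using inverse_power_summable[of 2, where 'a = real] by (simp add: power_one_over inverse_eq_divide)
  define S where "S = (\<Sum>k::nat. (1 / real k)\<^sup>2)"
  have "(\<lambda>n. (\<Sum>p\<in>small_primes n. (1 / real p)\<^sup>2) / ell2 n) \<longlonglongrightarrow> 0"
  proof (rule Lim_null_comparison)
    have "(\<Sum>p\<in>small_primes n. (1 / real p)\<^sup>2) \<le> S" for n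
      unfolding S_def by (rule sum_le_suminf[OF summ]) auto
    moreover have "eventually (\<lambda>n. ell2 n > 0) sequentially" unfolding ell2_def by real_asymp
    ultimately show "\<forall>\<^sub>F n in sequentially. norm ((\<Sum>p\<in>small_primes n. (1 / real p)\<^sup>2) / ell2 n) \<le> S / ell2 n"
      by (auto elim!: eventually_mono intro!: divide_right_mono simp: sum_nonneg abs_of_nonneg)
    show "(\<lambda>n. S / ell2 n) \<longlonglongrightarrow> 0" unfolding ell2_def by real_asymp
  qed
  from tendsto_diff[OF recip_sum_small_primes_ratio this]
  show ?thesis
    by (simp add: diff_divide_distrib[symmetric] recip_sum_def sum_subtractf[symmetric]
        power2_eq_square right_diff_distrib)
qed

text \<open>With z = exp (ln n / ell2 n), each of the three summands in the base is at most z once z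
  \<ge> 1. The power z^(N+1) equals n^((N+1) / ell2 n), whose exponent tends to 0.\<close>

lemma small_primes_power_negligible:
  "(\<lambda>n. real (N + 2) * (1 + (real (card (small_primes n)) + recip_sum (small_primes n))) ^ Suc N / real n) \<longlonglongrightarrow> 0"
proof (rule Lim_null_comparison)
  define E where "E = (\<lambda>n. exp (ln (real n) / ell2 n))"
  have "eventually (\<lambda>n. E n \<ge> 1) sequentially" unfolding E_def ell2_def by real_asymp
  then show "\<forall>\<^sub>F n in sequentially. norm (real (N + 2) * (1 + (real (card (small_primes n)) + recip_sum (small_primes n))) ^ Suc N / real n)
      \<le> real (N + 2) * (3 * E n) ^ Suc N / real n"
  proof eventually_elim
    case (elim n)
    have "small_primes n \<subseteq> {1..cutoff n}"
      by (auto simp: small_primes_def primes_upto_def dest: prime_gt_0_nat)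
    then have "card (small_primes n) \<le> cutoff n" using card_mono[of "{1..cutoff n}" "small_primes n"] by simp
    then have 1: "real (card (small_primes n)) \<le> E n" using cutoff_le[of n] by (simp add: E_def)
    have "recip_sum (small_primes n) \<le> (\<Sum>p\<in>small_primes n. 1)" unfolding recip_sum_def
      by (intro sum_mono) (auto dest!: prime_small_primes prime_ge_1_nat)
    then have "1 + (real (card (small_primes n)) + recip_sum (small_primes n)) \<le> 3 * E n"
      using 1 elim by simp
    then have "real (N + 2) * (1 + (real (card (small_primes n)) + recip_sum (small_primes n))) ^ Suc N / real n
        \<le> real (N + 2) * (3 * E n) ^ Suc N / real n"
      using recip_sum_nonneg[of "small_primes n"]
      by (intro divide_right_mono mult_left_mono power_mono) auto
    moreover have "0 \<le> real (N + 2) * (1 + (real (card (small_primes n)) + recip_sum (small_primes n))) ^ Suc N / real n"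
      using recip_sum_nonneg[of "small_primes n"] by simp
    ultimately show ?case by simp
  qed
  define M where "M = real (Suc N)"
  have M: "M > 0" by (simp add: M_def)
  have "(\<lambda>n. exp (M * (ln (real n) / ln (ln (real n)))) / real n) \<longlonglongrightarrow> 0"
    using M by real_asymp
  then have "(\<lambda>n. real (N + 2) * 3 ^ Suc N * (E n ^ Suc N / real n)) \<longlonglongrightarrow> 0"
    unfolding E_def ell2_def M_def exp_of_nat_mult by (rule tendsto_mult_right_zero)
  then show "(\<lambda>n. real (N + 2) * (3 * E n) ^ Suc N / real n) \<longlonglongrightarrow> 0"
    by (simp only: power_mult_distrib mult.assoc times_divide_eq_right)
qed

section \<open>Convergence of characteristic functions and the central limit theorem for small
  primes\<close>

lemma characteristic_function_limit:
  "(\<lambda>n. divisors_mean n (small_primes n)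
      (\<lambda>A. iexp (t * ((real (card A) - recip_sum (small_primes n)) / sqrt (ell2 n)))))
    \<longlonglongrightarrow> complex_of_real (exp (- (t\<^sup>2) / 2))"
proof -
  define \<theta> where "\<theta> = (\<lambda>n. t / sqrt (ell2 n))"
  define \<mu> where "\<mu> = (\<lambda>n. recip_sum (small_primes n))"
  define V where "V = (\<lambda>n. \<Sum>p\<in>small_primes n. (1 / real p) * (1 - 1 / real p))"
  define X where "X = (\<lambda>n. divisors_mean n (small_primes n) (\<lambda>A. iexp (\<theta> n * (real (card A) - \<mu> n))))"
  define Y where "Y = (\<lambda>n. model_mean (small_primes n) (\<lambda>A. iexp (\<theta> n * (real (card A) - \<mu> n))))"
  have \<theta>0: "\<theta> \<longlonglongrightarrow> 0" unfolding \<theta>_def ell2_def by real_asymp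
  have Lpos: "eventually (\<lambda>n. ell2 n > 0) sequentially" unfolding ell2_def by real_asymp
  have \<theta>2: "(\<lambda>n. (\<theta> n)\<^sup>2 * r n) \<longlonglongrightarrow> t\<^sup>2" if "(\<lambda>n. r n / ell2 n) \<longlonglongrightarrow> 1" for r
  proof -
    from that have "(\<lambda>n. t\<^sup>2 * (r n / ell2 n)) \<longlonglongrightarrow> t\<^sup>2 * 1" by (rule tendsto_mult_left)
    then have "(\<lambda>n. t\<^sup>2 * (r n / ell2 n)) \<longlonglongrightarrow> t\<^sup>2" by simp
    then show ?thesis
    proof (rule Lim_transform_eventually)
      show "\<forall>\<^sub>F n in sequentially. t\<^sup>2 * (r n / ell2 n) = (\<theta> n)\<^sup>2 * r n"
        using Lpos by eventually_elim (simp add: \<theta>_def power_divide)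
    qed
  qed
  have \<theta>\<mu>: "(\<lambda>n. (\<theta> n)\<^sup>2 * \<mu> n) \<longlonglongrightarrow> t\<^sup>2" unfolding \<mu>_def by (rule \<theta>2[OF recip_sum_small_primes_ratio])
  have \<theta>V: "(\<lambda>n. (\<theta> n)\<^sup>2 * V n) \<longlonglongrightarrow> t\<^sup>2" unfolding V_def by (rule \<theta>2[OF variance_small_primes_ratio])
  have small: "eventually (\<lambda>n. \<bar>2 * \<theta> n\<bar> \<le> 1) sequentially"
    using tendstoD[OF \<theta>0, of "1/2"] by (auto elim!: eventually_mono)

  have XY: "(\<lambda>n. X n - Y n) \<longlonglongrightarrow> 0"
  proof (rule tendstoI)
    fix \<epsilon> :: real assume \<epsilon>: "\<epsilon> > 0"
    \<comment> \<open>\<theta>^2 \<mu> tends to t^2 and so is eventually below t^2 + 1. Hence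
      \<open>c\<close> bounds the remainder's coefficient for all large n, and \<open>N\<close> can
      be chosen from \<epsilon> and t alone, before n.\<close>
    define c where "c = 4 * exp (4 * (t\<^sup>2 + 1))"
    have c: "c > 0" by (simp add: c_def)
    obtain N0 where N0: "(1 / 2 :: real) ^ N0 < \<epsilon> / 2 / c"
      using real_arch_pow_inv[of "\<epsilon> / 2 / c" "1 / 2"] c \<epsilon> by auto
    define N where "N = 2 * N0 + 1"
    have N: "odd N" by (simp add: N_def)
    have "c * (1 / 2) ^ Suc N \<le> c * (1 / 2) ^ N0"
      using c by (intro mult_left_mono power_decreasing) (auto simp: N_def)
    also have "\<dots> < \<epsilon> / 2" using N0 c by (simp add: pos_less_divide_eq mult.commute)
    finally have cN: "c * (1 / 2) ^ Suc N < \<epsilon> / 2" .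
    have "eventually (\<lambda>n. (\<theta> n)\<^sup>2 * \<mu> n < t\<^sup>2 + 1) sequentially"
      using order_tendstoD(2)[OF \<theta>\<mu>, of "t\<^sup>2 + 1"] by simp
    moreover have "eventually (\<lambda>n. real (N + 2) * (1 + (real (card (small_primes n)) + \<mu> n)) ^ Suc N / real n < \<epsilon> / 2) sequentially"
      using order_tendstoD(2)[OF small_primes_power_negligible[of N], of "\<epsilon> / 2"] \<epsilon> by (simp only: \<mu>_def half_gt_zero)
    ultimately show "eventually (\<lambda>n. dist (X n - Y n) 0 < \<epsilon>) sequentially"
      using small eventually_gt_at_top[of 0]
    proof eventually_elim
      case (elim n)
      have "cmod (X n - Y n) \<le> real (N + 2) * (1 + (real (card (small_primes n)) + \<mu> n)) ^ Suc N / real n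
          + 4 * (1 / 2) ^ Suc N * exp (4 * (\<theta> n)\<^sup>2 * \<mu> n)"
        unfolding X_def Y_def \<mu>_def
        using elim by (intro characteristic_functions_close N prime_small_primes) auto
      also have "4 * (1 / 2) ^ Suc N * exp (4 * (\<theta> n)\<^sup>2 * \<mu> n) \<le> 4 * (1 / 2) ^ Suc N * exp (4 * (t\<^sup>2 + 1))"
        using elim by (intro mult_left_mono) auto
      also have "\<dots> = c * (1 / 2) ^ Suc N" by (simp add: c_def)
      finally have "cmod (X n - Y n) < \<epsilon>" using cN elim(2) by linarith
      then show ?case by (simp add: dist_norm)
    qed
  qed

  have "(\<lambda>n. Y n - of_real (exp (- ((\<theta> n)\<^sup>2 / 2 * V n)))) \<longlonglongrightarrow> 0"
  proof (rule Lim_null_comparison)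
    show "\<forall>\<^sub>F n in sequentially. cmod (Y n - of_real (exp (- ((\<theta> n)\<^sup>2 / 2 * V n)))) \<le> \<bar>\<theta> n\<bar> ^ 3 * \<mu> n"
      using small
    proof eventually_elim
      case (elim n)
      then show ?case unfolding Y_def V_def \<mu>_def
        by (intro model_characteristic_function prime_small_primes) auto
    qed
    \<comment> \<open>Two of the three powers of \<theta> are absorbed by \<mu>; the third one tends
      to 0.\<close>
    have "(\<lambda>n. \<bar>\<theta> n\<bar> * ((\<theta> n)\<^sup>2 * \<mu> n)) \<longlonglongrightarrow> \<bar>0\<bar> * t\<^sup>2" by (intro tendsto_mult tendsto_rabs \<theta>0 \<theta>\<mu>)
    then show "(\<lambda>n. \<bar>\<theta> n\<bar> ^ 3 * \<mu> n) \<longlonglongrightarrow> 0"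
      by (simp add: power3_eq_cube power2_eq_square abs_mult_self_eq mult_ac)
  qed
  from tendsto_add[OF XY this]
  have "(\<lambda>n. X n - of_real (exp (- ((\<theta> n)\<^sup>2 / 2 * V n)))) \<longlonglongrightarrow> 0" by simp
  moreover have "(\<lambda>n. complex_of_real (exp (- ((\<theta> n)\<^sup>2 / 2 * V n)))) \<longlonglongrightarrow> of_real (exp (- (t\<^sup>2) / 2))"
  proof (intro tendsto_of_real tendsto_exp)
    from \<theta>V have "(\<lambda>n. - ((\<theta> n)\<^sup>2 * V n) / 2) \<longlonglongrightarrow> - (t\<^sup>2) / 2" by (intro tendsto_intros) auto
    then show "(\<lambda>n. - ((\<theta> n)\<^sup>2 / 2 * V n)) \<longlonglongrightarrow> - (t\<^sup>2) / 2" by simp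
  qed
  ultimately have "(\<lambda>n. X n - of_real (exp (- ((\<theta> n)\<^sup>2 / 2 * V n))) + of_real (exp (- ((\<theta> n)\<^sup>2 / 2 * V n))))
      \<longlonglongrightarrow> 0 + complex_of_real (exp (- (t\<^sup>2) / 2))"
    by (rule tendsto_add)
  then show ?thesis by (simp add: X_def \<theta>_def \<mu>_def)
qed

lemma prob_upto_eq: "A \<subseteq> {1..n} \<Longrightarrow> prob_upto n A = real (card A) / real n"
  by (simp add: measure_uniform_count_measure)

lemma isCont_std_normal_cdf: "isCont std_normal_cdf x"
proof -
  interpret real_distribution std_normal_distribution by (rule real_dist_normal_dist)
  have "emeasure std_normal_distribution {x} = 0"
    by (rule absolutely_continuousD[OF absolutely_continuousI_density]) auto
  then show ?thesis by (simp add: isCont_cdf measure_def)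
qed

lemma small_primes_central_limit:
  "(\<lambda>n. prob_upto n {m \<in> {1..n}. (real (card {p \<in> small_primes n. p dvd m}) - recip_sum (small_primes n))
      / sqrt (ell2 n) \<le> x}) \<longlonglongrightarrow> std_normal_cdf x"
proof -
  define Z where "Z = (\<lambda>n m. (real (card {p \<in> small_primes n. p dvd m}) - recip_sum (small_primes n)) / sqrt (ell2 n))"
  \<comment> \<open>The index is shifted because \<open>{1..0}\<close> is empty and carries no
    probability measure.\<close>
  define U where "U = (\<lambda>n. uniform_count_measure {1..Suc n})"
  define M where "M = (\<lambda>n. distr (U n) borel (Z (Suc n)))"
  interpret U: prob_space "U n" for n unfolding U_def by (intro prob_space_uniform_count_measure) auto
  have meas: "Z (Suc n) \<in> borel_measurable (U n)" for n
    by (simp add: U_def uniform_count_measure_def)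
  have rd: "real_distribution (M n)" for n
    unfolding M_def by (rule U.real_distribution_distr[OF meas])
  have "char (M n) t = divisors_mean (Suc n) (small_primes (Suc n))
      (\<lambda>A. iexp (t * ((real (card A) - recip_sum (small_primes (Suc n))) / sqrt (ell2 (Suc n)))))" for n t
  proof -
    have "char (M n) t = (CLINT m|U n. iexp (t * Z (Suc n) m))"
      unfolding char_def M_def by (rule integral_distr[OF meas]) simp
    also have "\<dots> = (\<Sum>m\<in>{1..Suc n}. (1 / real (Suc n)) *\<^sub>R iexp (t * Z (Suc n) m))"
      unfolding U_def uniform_count_measure_def
      by (subst lebesgue_integral_point_measure_finite) auto
    finally show ?thesis unfolding divisors_mean_def Z_def scaleR_sum_right .
  qed
  then have "weak_conv_m M std_normal_distribution"
    using LIMSEQ_Suc[OF characteristic_function_limit]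
    by (intro levy_continuity rd real_dist_normal_dist) (simp add: char_std_normal_distribution)
  moreover have "isCont std_normal_cdf x"
    by (rule isCont_std_normal_cdf)
  ultimately have "(\<lambda>n. cdf (M n) x) \<longlonglongrightarrow> std_normal_cdf x"
    by (simp add: weak_conv_m_def weak_conv_def)
  moreover have "cdf (M n) x = prob_upto (Suc n) {m \<in> {1..Suc n}. Z (Suc n) m \<le> x}" for n
  proof -
    have "cdf (M n) x = measure (U n) (Z (Suc n) -` {..x} \<inter> space (U n))"
      unfolding cdf_def M_def by (rule measure_distr[OF meas]) simp
    also have "Z (Suc n) -` {..x} \<inter> space (U n) = {m \<in> {1..Suc n}. Z (Suc n) m \<le> x}"
      by (auto simp: U_def space_uniform_count_measure)
    finally show ?thesis by (simp add: U_def)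
  qed
  ultimately have "(\<lambda>n. prob_upto (Suc n) {m \<in> {1..Suc n}. Z (Suc n) m \<le> x}) \<longlonglongrightarrow> std_normal_cdf x"
    by (simp only:)
  then have "(\<lambda>n. prob_upto n {m \<in> {1..n}. Z n m \<le> x}) \<longlonglongrightarrow> std_normal_cdf x"
    by (rule LIMSEQ_imp_Suc)
  then show ?thesis unfolding Z_def .
qed

section \<open>Transfer of convergence in distribution\<close>

lemma prob_upto_mono: "A \<subseteq> B \<Longrightarrow> B \<subseteq> {1..n} \<Longrightarrow> prob_upto n A \<le> prob_upto n B"
  by (subst (1 2) prob_upto_eq)
     (auto intro!: divide_right_mono card_mono elim: finite_subset)

lemma prob_upto_Un_le:
  assumes "C \<subseteq> A \<union> B" "A \<subseteq> {1..n}" "B \<subseteq> {1..n}"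
  shows "prob_upto n C \<le> prob_upto n A + prob_upto n B"
proof -
  have "finite (A \<union> B)" using assms(2,3) by (meson finite_UnI finite_atLeastAtMost finite_subset)
  then have "card C \<le> card A + card B"
    using card_mono[OF _ assms(1)] card_Un_le[of A B] by linarith
  then have "real (card C) \<le> real (card A) + real (card B)" by linarith
  moreover have "C \<subseteq> {1..n}" using assms by blast
  ultimately show ?thesis
    by (simp only: prob_upto_eq assms(2,3) add_divide_distrib[symmetric]) (intro divide_right_mono, auto)
qed

lemma prob_upto_all: "n > 0 \<Longrightarrow> prob_upto n {1..n} = 1"
  by (subst prob_upto_eq) auto

text \<open>A form of Slutsky's lemma: off a negligible set, f \<le> x lies between Z \<le> x -
  \<epsilon> and Z \<le> x + \<epsilon>. Points outside \<open>M n\<close> are counted in the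
  exceptional set, so the one hypothesis \<open>close\<close> also yields that the domains have
  asymptotically full measure.\<close>

lemma converges_in_distr_transfer:
  fixes Z :: "nat \<Rightarrow> nat \<Rightarrow> real"
  assumes Z: "\<And>x. (\<lambda>n. prob_upto n {m \<in> {1..n}. Z n m \<le> x}) \<longlonglongrightarrow> F x"
    and F: "\<And>x. isCont F x"
    and M: "\<And>n. M n \<subseteq> {1..n}"
    and close: "\<And>\<epsilon>. \<epsilon> > 0 \<Longrightarrow> (\<lambda>n. prob_upto n {m \<in> {1..n}. \<not> (m \<in> M n \<and> \<bar>f n m - Z n m\<bar> \<le> \<epsilon>)}) \<longlonglongrightarrow> 0"
  shows "converges_in_distr M f F"
  unfolding converges_in_distr_def
proof (intro conjI allI impI)
  show "\<forall>\<^sub>F n in sequentially. M n \<subseteq> {1..n}" using M by simp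
  define B where "B = (\<lambda>\<epsilon> n. {m \<in> {1..n}. \<not> (m \<in> M n \<and> \<bar>f n m - Z n m\<bar> \<le> \<epsilon>)})"
  have B: "(\<lambda>n. prob_upto n (B \<epsilon> n)) \<longlonglongrightarrow> 0" if "\<epsilon> > 0" for \<epsilon>
    unfolding B_def by (rule close[OF that])
  show "(\<lambda>n. prob_upto n (M n)) \<longlonglongrightarrow> 1"
  proof (rule tendsto_sandwich)
    show "\<forall>\<^sub>F n in sequentially. 1 - prob_upto n (B 1 n) \<le> prob_upto n (M n)"
      using eventually_gt_at_top[of 0]
    proof eventually_elim
      case (elim n)
      have "prob_upto n {1..n} \<le> prob_upto n (M n) + prob_upto n (B 1 n)"
        by (rule prob_upto_Un_le) (use M in \<open>auto simp: B_def\<close>)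
      then show ?case using prob_upto_all[OF elim] by linarith
    qed
    show "\<forall>\<^sub>F n in sequentially. prob_upto n (M n) \<le> 1"
      using eventually_gt_at_top[of 0]
    proof eventually_elim
      case (elim n)
      then show ?case using prob_upto_mono[OF M order_refl, of n] prob_upto_all[OF elim] by linarith
    qed
    show "(\<lambda>n. 1 - prob_upto n (B 1 n)) \<longlonglongrightarrow> 1" using tendsto_diff[OF tendsto_const B[of 1], of 1] by simp
  qed auto
  fix x
  show "(\<lambda>n. prob_upto n {m \<in> M n. f n m \<le> x}) \<longlonglongrightarrow> F x"
  proof (rule tendstoI)
    fix \<eta> :: real assume \<eta>: "\<eta> > 0"
    obtain d where d: "d > 0" "\<And>y. \<bar>y - x\<bar> < d \<Longrightarrow> \<bar>F y - F x\<bar> < \<eta> / 3"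
      using F[of x] \<eta> unfolding continuous_at_real_range by (metis divide_pos_pos real_norm_def zero_less_numeral)
    define \<epsilon> where "\<epsilon> = d / 2"
    have \<epsilon>: "\<epsilon> > 0" "\<bar>F (x + \<epsilon>) - F x\<bar> < \<eta> / 3" "\<bar>F (x - \<epsilon>) - F x\<bar> < \<eta> / 3"
      using d(1) d(2)[of "x + \<epsilon>"] d(2)[of "x - \<epsilon>"] by (simp_all add: \<epsilon>_def)
    \<comment> \<open>One third each for the convergence of \<open>Z\<close> at x + \<epsilon> or x
      - \<epsilon>, for the continuity of \<open>F\<close>, and for the exceptional set.\<close>
    have \<eta>3: "\<eta> / 3 > 0" using \<eta> by simp
    show "\<forall>\<^sub>F n in sequentially. dist (prob_upto n {m \<in> M n. f n m \<le> x}) (F x) < \<eta>"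
      using tendstoD[OF Z[of "x + \<epsilon>"] \<eta>3] tendstoD[OF Z[of "x - \<epsilon>"] \<eta>3] tendstoD[OF B[OF \<epsilon>(1)] \<eta>3]
    proof eventually_elim
      case (elim n)
      have "prob_upto n {m \<in> M n. f n m \<le> x} \<le> prob_upto n {m \<in> {1..n}. Z n m \<le> x + \<epsilon>} + prob_upto n (B \<epsilon> n)"
        by (rule prob_upto_Un_le; use M[of n] in \<open>force simp: B_def\<close>)
      moreover have "prob_upto n {m \<in> {1..n}. Z n m \<le> x - \<epsilon>} \<le> prob_upto n {m \<in> M n. f n m \<le> x} + prob_upto n (B \<epsilon> n)"
        by (rule prob_upto_Un_le; use M[of n] in \<open>force simp: B_def\<close>)
      ultimately show ?case using elim \<epsilon>(2,3) unfolding dist_real_def by linarith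
    qed
  qed
qed

section \<open>Restoring the large primes\<close>

lemma omega_split:
  assumes "m \<in> {1..n}" "cutoff n \<le> n"
  shows "omega m = card {p \<in> small_primes n. p dvd m} + card {p \<in> primes_upto n - small_primes n. p dvd m}"
proof -
  have "prime_factors m = {p \<in> small_primes n. p dvd m} \<union> {p \<in> primes_upto n - small_primes n. p dvd m}"
    using assms
    by (auto simp: prime_factors_dvd small_primes_def primes_upto_def intro: order_trans dest: dvd_imp_le)
  then show ?thesis unfolding omega_def by (simp, subst card_Un_disjoint) auto
qed

text \<open>The first-moment bound that feeds Markov's inequality for the large primes.\<close>

lemma sum_card_prime_divisors_le:
  assumes "finite Q" "\<And>p. p \<in> Q \<Longrightarrow> prime p"
  shows "(\<Sum>m\<in>{1..n}. real (card {p \<in> Q. p dvd m})) \<le> real n * recip_sum Q"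
proof -
  have "(\<Sum>m\<in>{1..n}. card {p \<in> Q. p dvd m}) = (\<Sum>p\<in>Q. n div p)"
    using assms by (intro sum_multicount_gen) (auto intro!: card_multiples_upto[simplified] prime_gt_0_nat)
  then have "(\<Sum>m\<in>{1..n}. real (card {p \<in> Q. p dvd m})) = (\<Sum>p\<in>Q. real (n div p))"
    by (metis (no_types, lifting) of_nat_sum sum.cong)
  also have "\<dots> \<le> (\<Sum>p\<in>Q. real n / real p)" by (intro sum_mono of_nat_div_le_of_nat)
  also have "\<dots> = real n * recip_sum Q" by (simp add: recip_sum_def sum_distrib_left)
  finally show ?thesis .
qed

text \<open>The number of large prime divisors is nonnegative with mean o(sqrt (ell2 n)), so
  Markov's inequality makes it negligible in probability. Recentring from \<mu> n to ell2 n is a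
  deterministic shift that tends to 0 after scaling.\<close>

theorem erdos_kac:
  "(\<lambda>n. prob_upto n {m \<in> {1..n}. (real (omega m) - ell2 n) / sqrt (ell2 n) \<le> x}) \<longlonglongrightarrow> std_normal_cdf x"
proof -
  define c where "c = (\<lambda>n m. real (card {p \<in> small_primes n. p dvd m}))"
  define Q where "Q = (\<lambda>n. primes_upto n - small_primes n)"
  define r where "r = (\<lambda>n m. real (card {p \<in> Q n. p dvd m}))"
  define \<mu> where "\<mu> = (\<lambda>n. recip_sum (small_primes n))"
  have cut: "eventually (\<lambda>n. cutoff n \<le> n) sequentially"
  proof -
    have "eventually (\<lambda>n. real_of_int \<lfloor>exp (ln (real n) / ln (ln (real n)))\<rfloor> \<le> real n) sequentially"
      by real_asymp
    then show ?thesis unfolding real_cutoff[symmetric] by simp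
  qed
  have Lpos: "eventually (\<lambda>n. ell2 n > 0) sequentially" unfolding ell2_def by real_asymp
  have "converges_in_distr (\<lambda>n. {1..n}) (\<lambda>n m. (real (omega m) - ell2 n) / sqrt (ell2 n)) std_normal_cdf"
  proof (rule converges_in_distr_transfer[where Z = "\<lambda>n m. (c n m - \<mu> n) / sqrt (ell2 n)"])
    show "(\<lambda>n. prob_upto n {m \<in> {1..n}. (c n m - \<mu> n) / sqrt (ell2 n) \<le> x}) \<longlonglongrightarrow> std_normal_cdf x" for x
      unfolding c_def \<mu>_def by (rule small_primes_central_limit)
    show "isCont std_normal_cdf x" for x by (rule isCont_std_normal_cdf)
    fix \<epsilon> :: real assume \<epsilon>: "\<epsilon> > 0"
    show "(\<lambda>n. prob_upto n {m \<in> {1..n}. \<not> (m \<in> {1..n} \<and>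
        \<bar>(real (omega m) - ell2 n) / sqrt (ell2 n) - (c n m - \<mu> n) / sqrt (ell2 n)\<bar> \<le> \<epsilon>)}) \<longlonglongrightarrow> 0"
    proof (rule Lim_null_comparison)
      have "eventually (\<lambda>n. \<bar>(\<mu> n - ell2 n) / sqrt (ell2 n)\<bar> < \<epsilon> / 2) sequentially"
        using tendstoD[OF recip_sum_small_primes_asymp(1), of "\<epsilon> / 2"] \<epsilon> by (simp add: \<mu>_def)
      then show "\<forall>\<^sub>F n in sequentially. norm (prob_upto n {m \<in> {1..n}. \<not> (m \<in> {1..n} \<and>
          \<bar>(real (omega m) - ell2 n) / sqrt (ell2 n) - (c n m - \<mu> n) / sqrt (ell2 n)\<bar> \<le> \<epsilon>)})
        \<le> 2 / \<epsilon> * ((recip_sum (primes_upto n) - \<mu> n) / sqrt (ell2 n))"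
        using cut Lpos eventually_gt_at_top[of 0]
      proof eventually_elim
        case (elim n)
        define s where "s = sqrt (ell2 n)"
        have s: "s > 0" using elim by (simp add: s_def)
        define Bad where "Bad = {m \<in> {1..n}. \<not> (m \<in> {1..n} \<and>
          \<bar>(real (omega m) - ell2 n) / sqrt (ell2 n) - (c n m - \<mu> n) / sqrt (ell2 n)\<bar> \<le> \<epsilon>)}"
        \<comment> \<open>The shift of the centre accounts for less than \<epsilon> / 2 of the
          discrepancy, so the large primes must supply the other half.\<close>
        have Bad: "\<epsilon> / 2 * s \<le> r n m" if "m \<in> Bad" for m
        proof -
          have "m \<in> {1..n}" using that by (simp add: Bad_def)
          from omega_split[OF this elim(2)] have "real (omega m) = c n m + r n m"
            by (simp add: c_def r_def Q_def)
          then have "(real (omega m) - ell2 n) / s - (c n m - \<mu> n) / s = r n m / s + (\<mu> n - ell2 n) / s"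
            by (simp add: add_divide_distrib diff_divide_distrib)
          moreover have "\<not> \<bar>(real (omega m) - ell2 n) / s - (c n m - \<mu> n) / s\<bar> \<le> \<epsilon>"
            using that by (auto simp: Bad_def s_def)
          moreover have "\<bar>(\<mu> n - ell2 n) / s\<bar> < \<epsilon> / 2" using elim(1) by (simp add: s_def)
          moreover have "0 \<le> r n m / s" using s by (simp add: r_def)
          ultimately have "\<epsilon> / 2 \<le> r n m / s" by linarith
          then show ?thesis using s by (simp add: pos_le_divide_eq)
        qed
        have fin: "finite Bad" "Bad \<subseteq> {1..n}" by (auto simp: Bad_def)
        \<comment> \<open>Markov's inequality, in counting form.\<close>
        have "real (card Bad) * (\<epsilon> / 2 * s) \<le> (\<Sum>m\<in>Bad. r n m)"
          using sum_bounded_below[of Bad "\<epsilon> / 2 * s" "r n"] Bad by simp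
        also have "\<dots> \<le> (\<Sum>m\<in>{1..n}. r n m)" using fin by (intro sum_mono2) (auto simp: r_def)
        also have "\<dots> \<le> real n * recip_sum (Q n)" unfolding r_def
          by (rule sum_card_prime_divisors_le) (auto simp: Q_def primes_upto_def)
        also have "recip_sum (Q n) = recip_sum (primes_upto n) - \<mu> n"
          unfolding recip_sum_def \<mu>_def Q_def using elim(2)
          by (intro sum_diff) (auto simp: small_primes_def primes_upto_def)
        finally have "real (card Bad) / real n \<le> 2 / \<epsilon> * ((recip_sum (primes_upto n) - \<mu> n) / s)"
          using s \<epsilon> elim(4) by (simp add: field_simps)
        moreover have "norm (prob_upto n Bad) = real (card Bad) / real n"
          unfolding prob_upto_eq[OF fin(2)] by simp
        ultimately show ?case unfolding Bad_def[symmetric] unfolding s_def[symmetric]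
          by (simp only:)
      qed
      show "(\<lambda>n. 2 / \<epsilon> * ((recip_sum (primes_upto n) - \<mu> n) / sqrt (ell2 n))) \<longlonglongrightarrow> 0"
        unfolding \<mu>_def by (intro tendsto_mult_right_zero recip_sum_small_primes_asymp(2))
    qed
  qed auto
  then show ?thesis using isCont_std_normal_cdf by (simp add: converges_in_distr_def)
qed

section \<open>The delta method\<close>

text \<open>
  For \<open>m \<ge> \<surd>n\<close> one has \<open>ell2 n - ln 2 \<le> ell2 m \<le> ell2 n\<close>, so that the normalisation by \<open>ell2 m\<close>
  may be replaced by the one by \<open>ell2 n\<close>.
\<close>

lemma delta_method_pointwise:
  fixes g :: "real \<Rightarrow> real"
  assumes "\<delta> > 0" "{1 - \<delta>..1 + \<delta>} \<subseteq> D" "(g has_real_derivative d) (at 1)" "d \<noteq> 0" "K > 0" "\<epsilon> > 0"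
  shows "\<forall>\<^sub>F n in sequentially. \<forall>m\<in>{1..n}. n \<le> m * m \<longrightarrow>
    \<bar>(real (omega m) - ell2 n) / sqrt (ell2 n)\<bar> \<le> K \<longrightarrow>
    m \<in> ratio_domain D n \<and>
    \<bar>(g (real (omega m) / ell2 m) - g 1) / (d / sqrt (ell2 m))
      - (real (omega m) - ell2 n) / sqrt (ell2 n)\<bar> \<le> \<epsilon>"
proof -
  \<comment> \<open>Chosen so that e (K + 1) / \<bar>d\<bar> = \<epsilon> / 2, where K + 1 will
    bound the rescaled deviation \<open>v\<close>.\<close>
  define e where "e = \<epsilon> * \<bar>d\<bar> / (2 * (K + 1))"
  have e: "e > 0" using assms by (simp add: e_def)
  obtain \<eta> where \<eta>: "\<eta> > 0" "\<And>h. \<bar>h\<bar> < \<eta> \<Longrightarrow> \<bar>g (1 + h) - g 1 - d * h\<bar> \<le> e * \<bar>h\<bar>"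
  proof -
    from assms(3) have "(g has_derivative (\<lambda>h. d * h)) (at 1)" by (simp add: has_field_derivative_def)
    then obtain \<eta> where \<eta>: "\<eta> > 0" "\<And>y. norm (y - 1) < \<eta> \<Longrightarrow> norm (g y - g 1 - d * (y - 1)) \<le> e * norm (y - 1)"
      using e unfolding has_derivative_at_alt by blast
    have "\<bar>g (1 + h) - g 1 - d * h\<bar> \<le> e * \<bar>h\<bar>" if "\<bar>h\<bar> < \<eta>" for h
      using \<eta>(2)[of "1 + h"] that by simp
    then show ?thesis using \<eta>(1) that by blast
  qed
  define b where "b = min \<eta> \<delta>"
  have b: "b > 0" using \<eta>(1) assms(1) by (simp add: b_def)
  \<comment> \<open>The three limits concern functions of L = ell2 n alone, which makes the
    estimates uniform in m. They will bound \<bar>h\<bar>, \<bar>v - W\<bar> and \<bar>v\<bar>, in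
    this order.\<close>
  have "((\<lambda>L::real. (K * sqrt L + ln 2) / (L - ln 2)) \<longlongrightarrow> 0) at_top"
    using assms(5) by real_asymp
  then have 1: "eventually (\<lambda>L. (K * sqrt L + ln 2) / (L - ln 2) < b) at_top"
    using b by (rule order_tendstoD)
  have "((\<lambda>L::real. K * (sqrt L / sqrt (L - ln 2) - 1) + ln 2 / sqrt (L - ln 2)) \<longlongrightarrow> 0) at_top"
    using assms(5) by real_asymp
  then have 2: "eventually (\<lambda>L. K * (sqrt L / sqrt (L - ln 2) - 1) + ln 2 / sqrt (L - ln 2) < \<epsilon> / 2) at_top"
    using assms(6) by (intro order_tendstoD) auto
  have "((\<lambda>L::real. (K * sqrt L + ln 2) / sqrt (L - ln 2)) \<longlongrightarrow> K) at_top"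
    using assms(5) by real_asymp
  then have 3: "eventually (\<lambda>L. (K * sqrt L + ln 2) / sqrt (L - ln 2) < K + 1) at_top"
    by (intro order_tendstoD) auto
  have 4: "eventually (\<lambda>L::real. L > 1 + ln 2) at_top" by (rule eventually_gt_at_top)
  have "eventually (\<lambda>n. (K * sqrt (ell2 n) + ln 2) / (ell2 n - ln 2) < b \<and>
      K * (sqrt (ell2 n) / sqrt (ell2 n - ln 2) - 1) + ln 2 / sqrt (ell2 n - ln 2) < \<epsilon> / 2 \<and>
      (K * sqrt (ell2 n) + ln 2) / sqrt (ell2 n - ln 2) < K + 1 \<and> ell2 n > 1 + ln 2) sequentially"
    using eventually_conj[OF 1 eventually_conj[OF 2 eventually_conj[OF 3 4]]] ell2_at_top
    by (rule eventually_compose_filterlim)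
  then show ?thesis using eventually_ge_at_top[of 9]
  proof (eventually_elim, intro ballI impI)
    fix n m
    assume "(K * sqrt (ell2 n) + ln 2) / (ell2 n - ln 2) < b \<and>
      K * (sqrt (ell2 n) / sqrt (ell2 n - ln 2) - 1) + ln 2 / sqrt (ell2 n - ln 2) < \<epsilon> / 2 \<and>
      (K * sqrt (ell2 n) + ln 2) / sqrt (ell2 n - ln 2) < K + 1 \<and> ell2 n > 1 + ln 2"
    moreover define L where "L = ell2 n"
    ultimately have as: "(K * sqrt L + ln 2) / (L - ln 2) < b"
      "K * (sqrt L / sqrt (L - ln 2) - 1) + ln 2 / sqrt (L - ln 2) < \<epsilon> / 2"
      "(K * sqrt L + ln 2) / sqrt (L - ln 2) < K + 1" "L > 1 + ln 2" by auto
    assume n: "9 \<le> n" and m: "m \<in> {1..n}" "n \<le> m * m"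
      and WK: "\<bar>(real (omega m) - ell2 n) / sqrt (ell2 n)\<bar> \<le> K"
    define a where "a = ell2 m"
    define W where "W = (real (omega m) - L) / sqrt L"
    have W: "\<bar>W\<bar> \<le> K" using WK by (simp add: W_def L_def)
    \<comment> \<open>\<open>9 \<le> n \<le> m * m\<close> keeps m in the range where
      \<open>ell2 m\<close> is positive.\<close>
    have m3: "m \<ge> 3"
    proof (rule ccontr)
      assume "\<not> m \<ge> 3"
      then have "m * m \<le> 2 * 2" by (intro mult_mono) auto
      then show False using n m by simp
    qed
    have lnm: "ln (real m) > 0" "ln (real n) > 0" using m3 n by simp_all
    have "ln (real n) \<le> ln (real m * real m)"
      using m m3 n by (subst ln_le_cancel_iff) (auto simp flip: of_nat_mult)
    also have "\<dots> = 2 * ln (real m)" using m3 by (simp add: ln_mult)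
    finally have "ln (ln (real n)) \<le> ln (2 * ln (real m))" using lnm by (subst ln_le_cancel_iff) auto
    then have a1: "L - ln 2 \<le> a" using lnm by (simp add: L_def a_def ell2_def ln_mult)
    have a2: "a \<le> L" unfolding L_def a_def ell2_def using lnm m m3 by (subst ln_le_cancel_iff) auto
    have ln2: "ln 2 > (0::real)" by simp
    have pos: "L - ln 2 > 0" "a > 0" "L > 0" using as(4) a1 ln2 by linarith+
    define h where "h = real (omega m) / a - 1"
    \<comment> \<open>\<open>v\<close> is the deviation of omega m normalised by ell2 m, and
      \<open>W\<close> the one normalised by ell2 n. Linearising g leads to \<open>v\<close>;
      comparing the normalisations leads from \<open>v\<close> to \<open>W\<close>. Each passage
      costs \<epsilon> / 2.\<close>
    define v where "v = h * sqrt a"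
    have om: "real (omega m) = W * sqrt L + L" using pos by (simp add: W_def)
    have num: "\<bar>W * sqrt L + (L - a)\<bar> \<le> K * sqrt L + ln 2"
    proof -
      have "\<bar>W * sqrt L + (L - a)\<bar> \<le> \<bar>W\<bar> * sqrt L + \<bar>L - a\<bar>"
        using pos by (intro order_trans[OF abs_triangle_ineq]) (simp add: abs_mult)
      also have "\<dots> \<le> K * sqrt L + ln 2" using W a1 a2 pos by (intro add_mono mult_right_mono) auto
      finally show ?thesis .
    qed
    have num0: "0 \<le> K * sqrt L + ln 2" using num abs_ge_zero order_trans by blast
    have h_eq: "h = (W * sqrt L + (L - a)) / a" using pos om by (simp add: h_def diff_divide_distrib add_divide_distrib)
    have "\<bar>h\<bar> = \<bar>W * sqrt L + (L - a)\<bar> / a" using pos by (simp add: h_eq)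
    also have "\<dots> \<le> (K * sqrt L + ln 2) / (L - ln 2)" using num num0 pos a1 by (intro frac_le) auto
    finally have h: "\<bar>h\<bar> < \<eta>" "\<bar>h\<bar> < \<delta>" using as(1) by (auto simp: b_def)
    have sq: "sqrt a * sqrt a = a" "sqrt a > 0" "sqrt (L - ln 2) > 0" "sqrt (L - ln 2) \<le> sqrt a" "sqrt a \<le> sqrt L"
      using pos a1 a2 by simp_all
    have "x / (y * y) * y = x / y" for x y :: real by simp
    from this[of _ "sqrt a"] have v_eq: "v = (W * sqrt L + (L - a)) / sqrt a"
      unfolding v_def h_eq sq(1) .
    have "\<bar>v\<bar> = \<bar>W * sqrt L + (L - a)\<bar> / sqrt a" using sq by (simp add: v_eq)
    also have "\<dots> \<le> (K * sqrt L + ln 2) / sqrt (L - ln 2)" using num num0 sq by (intro frac_le) auto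
    finally have v: "\<bar>v\<bar> \<le> K + 1" using as(3) by linarith
    have ratio: "real (omega m) / a = 1 + h" by (simp add: h_def)
    have "m \<in> ratio_domain D n"
    proof -
      have "1 + h \<in> {1 - \<delta>..1 + \<delta>}" using h(2) by auto
      then have "real (omega m) / ell2 m \<in> D" using assms(2) ratio by (auto simp: a_def)
      then show ?thesis using m m3 by (simp add: ratio_domain_def)
    qed
    moreover have "\<bar>(g (1 + h) - g 1) / (d / sqrt a) - v\<bar> \<le> \<epsilon> / 2"
    proof -
      have "(g (1 + h) - g 1) / (d / sqrt a) - v = (g (1 + h) - g 1 - d * h) * sqrt a / d"
        using assms(4) by (simp add: v_def field_simps)
      also have "\<bar>\<dots>\<bar> = \<bar>g (1 + h) - g 1 - d * h\<bar> * sqrt a / \<bar>d\<bar>" using pos by (simp add: abs_mult)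
      also have "\<dots> \<le> (e * \<bar>h\<bar>) * sqrt a / \<bar>d\<bar>"
        using \<eta>(2)[OF h(1)] pos by (intro divide_right_mono mult_right_mono) auto
      also have "\<dots> = e * \<bar>v\<bar> / \<bar>d\<bar>" using pos by (simp add: v_def abs_mult)
      also have "\<dots> \<le> e * (K + 1) / \<bar>d\<bar>" using v e by (intro divide_right_mono mult_left_mono) auto
      also have "\<dots> = \<epsilon> / 2"
      proof -
        have "x * y / (2 * z) * z / y = x / 2" if "y \<noteq> 0" "z \<noteq> 0" for x y z :: real using that by simp
        from this[of "\<bar>d\<bar>" "K + 1" \<epsilon>] show ?thesis using assms(4,5) by (simp only: e_def)
      qed
      finally show ?thesis .
    qed
    moreover have "\<bar>v - W\<bar> \<le> \<epsilon> / 2"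
    proof -
      have "v - W = W * (sqrt L / sqrt a - 1) + (L - a) / sqrt a"
        by (simp add: v_eq algebra_simps add_divide_distrib diff_divide_distrib)
      also have "\<bar>\<dots>\<bar> \<le> \<bar>W\<bar> * \<bar>sqrt L / sqrt a - 1\<bar> + \<bar>(L - a) / sqrt a\<bar>"
        by (intro order_trans[OF abs_triangle_ineq]) (simp add: abs_mult)
      also have "\<dots> \<le> K * (sqrt L / sqrt (L - ln 2) - 1) + ln 2 / sqrt (L - ln 2)"
      proof (intro add_mono mult_mono W)
        have "1 \<le> sqrt L / sqrt a" using sq by simp
        moreover have "sqrt L / sqrt a \<le> sqrt L / sqrt (L - ln 2)" using sq pos by (intro divide_left_mono) auto
        ultimately show "\<bar>sqrt L / sqrt a - 1\<bar> \<le> sqrt L / sqrt (L - ln 2) - 1" by linarith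
        have "\<bar>(L - a) / sqrt a\<bar> = (L - a) / sqrt a" using a2 sq by simp
        also have "\<dots> \<le> ln 2 / sqrt (L - ln 2)" using a1 a2 sq by (intro frac_le) auto
        finally show "\<bar>(L - a) / sqrt a\<bar> \<le> ln 2 / sqrt (L - ln 2)" .
      qed (use assms(5) in auto)
      finally show ?thesis using as(2) by linarith
    qed
    ultimately show "m \<in> ratio_domain D n \<and>
      \<bar>(g (real (omega m) / ell2 m) - g 1) / (d / sqrt (ell2 m)) - (real (omega m) - ell2 n) / sqrt (ell2 n)\<bar> \<le> \<epsilon>"
      unfolding a_def[symmetric] ratio L_def[symmetric] W_def[symmetric] by linarith
  qed
qed

section \<open>Negligible exceptional sets and the conclusion\<close>

lemma prob_below_sqrt: "(\<lambda>n. prob_upto n {m \<in> {1..n}. \<not> n \<le> m * m}) \<longlonglongrightarrow> 0"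
proof (rule Lim_null_comparison)
  show "\<forall>\<^sub>F n in sequentially. norm (prob_upto n {m \<in> {1..n}. \<not> n \<le> m * m}) \<le> sqrt (real n) / real n"
  proof (rule always_eventually, rule allI)
    fix n :: nat
    have "{m \<in> {1..n}. \<not> n \<le> m * m} \<subseteq> {1..nat \<lfloor>sqrt (real n)\<rfloor>}"
    proof
      fix m assume m: "m \<in> {m \<in> {1..n}. \<not> n \<le> m * m}"
      then have "m * m \<le> n" by simp
      then have "real (m * m) \<le> real n" by (rule of_nat_mono)
      then have "real m \<le> sqrt (real n)" by (intro real_le_rsqrt) (simp add: power2_eq_square)
      then show "m \<in> {1..nat \<lfloor>sqrt (real n)\<rfloor>}" using m by (auto simp: le_nat_iff le_floor_iff)
    qed
    then have "card {m \<in> {1..n}. \<not> n \<le> m * m} \<le> nat \<lfloor>sqrt (real n)\<rfloor>"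
      using card_mono[of "{1..nat \<lfloor>sqrt (real n)\<rfloor>}"] by fastforce
    then have "real (card {m \<in> {1..n}. \<not> n \<le> m * m}) \<le> sqrt (real n)"
      by (meson of_nat_floor order_trans of_nat_mono real_sqrt_ge_zero of_nat_0_le_iff)
    moreover have "prob_upto n {m \<in> {1..n}. \<not> n \<le> m * m} = real (card {m \<in> {1..n}. \<not> n \<le> m * m}) / real n"
      by (rule prob_upto_eq) auto
    ultimately show "norm (prob_upto n {m \<in> {1..n}. \<not> n \<le> m * m}) \<le> sqrt (real n) / real n"
      by (simp add: divide_right_mono)
  qed
  show "(\<lambda>n. sqrt (real n) / real n) \<longlonglongrightarrow> 0" by real_asymp
qed

text \<open>Tightness is what makes the linearisation usable, as it is uniform only over deviations
  bounded by a fixed \<open>K\<close>. Convergence at the two points K and - K carries the small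
  tails of the normal law over to large n.\<close>

lemma erdos_kac_tight:
  assumes "\<eta> > 0"
  obtains K where "K > 0"
    "\<forall>\<^sub>F n in sequentially. prob_upto n {m \<in> {1..n}. \<not> \<bar>(real (omega m) - ell2 n) / sqrt (ell2 n)\<bar> \<le> K} < \<eta>"
proof -
  interpret real_distribution std_normal_distribution by (rule real_dist_normal_dist)
  have \<eta>: "\<eta> / 4 > 0" using assms by simp
  have "eventually (\<lambda>K. std_normal_cdf K > 1 - \<eta> / 4) at_top"
    using order_tendstoD(1)[OF cdf_lim_at_top_prob] \<eta> by simp
  moreover have "eventually (\<lambda>K. std_normal_cdf (- K) < \<eta> / 4) at_top"
    using order_tendstoD(2)[OF cdf_lim_at_bot \<eta>] by (simp add: at_bot_mirror eventually_filtermap)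
  ultimately have "eventually (\<lambda>K. std_normal_cdf K > 1 - \<eta> / 4 \<and> std_normal_cdf (- K) < \<eta> / 4 \<and> K > 0) at_top"
    using eventually_gt_at_top[of 0] by eventually_elim simp
  then obtain K where K: "std_normal_cdf K > 1 - \<eta> / 4" "std_normal_cdf (- K) < \<eta> / 4" "K > 0"
    using eventually_happens'[OF trivial_limit_at_top_linorder] by blast
  define W where "W = (\<lambda>n m. (real (omega m) - ell2 n) / sqrt (ell2 n))"
  have EK: "(\<lambda>n. prob_upto n {m \<in> {1..n}. W n m \<le> x}) \<longlonglongrightarrow> std_normal_cdf x" for x
    unfolding W_def by (rule erdos_kac)
  have "\<forall>\<^sub>F n in sequentially. prob_upto n {m \<in> {1..n}. \<not> \<bar>W n m\<bar> \<le> K} < \<eta>"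
    using order_tendstoD(1)[OF EK K(1)] order_tendstoD(2)[OF EK K(2)] eventually_gt_at_top[of 0]
  proof eventually_elim
    case (elim n)
    have "prob_upto n {m \<in> {1..n}. \<not> \<bar>W n m\<bar> \<le> K}
        \<le> prob_upto n {m \<in> {1..n}. W n m \<le> - K} + prob_upto n {m \<in> {1..n}. \<not> W n m \<le> K}"
      by (rule prob_upto_Un_le) auto
    moreover have "prob_upto n {m \<in> {1..n}. \<not> W n m \<le> K} = 1 - prob_upto n {m \<in> {1..n}. W n m \<le> K}"
    proof -
      have "card {m \<in> {1..n}. \<not> W n m \<le> K} + card {m \<in> {1..n}. W n m \<le> K}
          = card ({m \<in> {1..n}. \<not> W n m \<le> K} \<union> {m \<in> {1..n}. W n m \<le> K})"
        by (rule card_Un_disjoint[symmetric]) auto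
      also have "{m \<in> {1..n}. \<not> W n m \<le> K} \<union> {m \<in> {1..n}. W n m \<le> K} = {1..n}" by auto
      finally have "real (card {m \<in> {1..n}. \<not> W n m \<le> K}) = real n - real (card {m \<in> {1..n}. W n m \<le> K})"
        by simp
      then show ?thesis using elim(3) by (subst (1 2) prob_upto_eq) (auto simp: diff_divide_distrib)
    qed
    ultimately show ?case using elim assms by linarith
  qed
  then show ?thesis using that[OF K(3)] by (simp add: W_def)
qed

theorem theorem1:
  fixes g :: "real \<Rightarrow> real" and D :: "real set" and \<delta> :: real
  assumes "\<delta> > 0" and "{1 - \<delta>..1 + \<delta>} \<subseteq> D"
    and "g differentiable (at 1)" and "deriv g 1 \<noteq> 0"
  shows "converges_in_distr (ratio_domain D)
    (\<lambda>n m. (g (real (omega m) / ell2 m) - g 1) / (deriv g 1 / sqrt (ell2 m)))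
    std_normal_cdf"
proof (rule converges_in_distr_transfer[OF erdos_kac isCont_std_normal_cdf])
  show "ratio_domain D n \<subseteq> {1..n}" for n by (auto simp: ratio_domain_def)
  have g': "(g has_real_derivative deriv g 1) (at 1)"
    using assms(3) by (metis DERIV_deriv_iff_real_differentiable)
  fix \<epsilon> :: real assume \<epsilon>: "\<epsilon> > 0"
  define W where "W = (\<lambda>n m. (real (omega m) - ell2 n) / sqrt (ell2 n))"
  define Bad where "Bad = (\<lambda>n. {m \<in> {1..n}. \<not> (m \<in> ratio_domain D n \<and>
    \<bar>(g (real (omega m) / ell2 m) - g 1) / (deriv g 1 / sqrt (ell2 m)) - W n m\<bar> \<le> \<epsilon>)})"
  have "(\<lambda>n. prob_upto n (Bad n)) \<longlonglongrightarrow> 0"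
  proof (rule tendstoI)
    fix \<eta> :: real assume "\<eta> > 0"
    then have \<eta>: "\<eta> / 2 > 0" by simp
    \<comment> \<open>\<open>K\<close> depends on \<eta> but not on n, as the pointwise estimate
      holds eventually for each fixed \<open>K\<close>.\<close>
    obtain K where K: "K > 0" "\<forall>\<^sub>F n in sequentially. prob_upto n {m \<in> {1..n}. \<not> \<bar>W n m\<bar> \<le> K} < \<eta> / 2"
      using erdos_kac_tight[OF \<eta>] unfolding W_def by blast
    show "\<forall>\<^sub>F n in sequentially. dist (prob_upto n (Bad n)) 0 < \<eta>"
      using K(2) order_tendstoD(2)[OF prob_below_sqrt \<eta>]
        delta_method_pointwise[OF assms(1,2) g' assms(4) K(1) \<epsilon>]
    proof eventually_elim
      case (elim n)
      \<comment> \<open>A bad m has either a large deviation or a square below n; everything else is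
        covered by the pointwise estimate.\<close>
      have "prob_upto n (Bad n) \<le> prob_upto n {m \<in> {1..n}. \<not> \<bar>W n m\<bar> \<le> K}
          + prob_upto n {m \<in> {1..n}. \<not> n \<le> m * m}"
        using elim(3) by (intro prob_upto_Un_le) (auto simp: Bad_def W_def)
      then show ?case using elim by (simp add: measure_nonneg)
    qed
  qed
  then show "(\<lambda>n. prob_upto n {m \<in> {1..n}. \<not> (m \<in> ratio_domain D n \<and>
    \<bar>(g (real (omega m) / ell2 m) - g 1) / (deriv g 1 / sqrt (ell2 m))
      - (real (omega m) - ell2 n) / sqrt (ell2 n)\<bar> \<le> \<epsilon>)}) \<longlonglongrightarrow> 0"
    unfolding Bad_def W_def .
qed

end
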